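(* Let $N\ge 1$ and consider the multi-type TASEP on a ring of $N$ sites $1,\dots,N$ with exactly one particle of each label $1,\dots,N$ (so a state is a word $u=u_1u_2\cdots u_N$, a permutation of $[N]$, read along the ring). Let $u$ be sampled from its stationary distribution. Fix integers $N\ge x_n>x_{n-1}>\dots>x_2\ge 1$. Then the probability that $u_1u_2\cdots u_{n-1}=x_nx_{n-1}\cdots x_2$ equals \[\frac{1}{\prod_{i=1}^{n-1}\binom Ni}\det\left(\binom{x_{i+1}}{j-1}\right)_{i,j=1}^{n-1}.\]
   Context: Multi-type TASEP on a ring: the sites $1,\dots,N$ are arranged cyclically, each occupied by one particle with a label. In each transition a particle is chosen uniformly at random and tries to jump to the site on its left (cyclically): if that site is vacant it moves there; if that site holds a particle with a larger label, the two particles exchange places; otherwise nothing happens. The chain is irreducible on the set of states and has a unique stationary distribution. *)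

theory Defs
  imports
    "HOL-Probability.Probability_Mass_Function"
    "HOL-Combinatorics.Multiset_Permutations"
    "Jordan_Normal_Form.Determinant"
begin

text \<open>
  A state is a word given as a list \<open>u\<close>, with site \<open>k\<close> (for \<open>1 \<le> k \<le> N\<close>) stored at list
  position \<open>k - 1\<close>. Every site is occupied, so choosing a particle uniformly at random is choosing
  a position uniformly at random, and the left neighbour of a position is its cyclic predecessor.
\<close>

definition left_nb :: "nat \<Rightarrow> nat \<Rightarrow> nat" where
  "left_nb N i = (if i = 0 then N - 1 else i - 1)"

definition tasep_jump :: "nat list \<Rightarrow> nat \<Rightarrow> nat list" where
  "tasep_jump u i =
    (let l = left_nb (length u) i
     in if u ! i < u ! l then u[l := u ! i, i := u ! l] else u)"

definition tasep_kernel :: "nat list \<Rightarrow> nat list pmf" where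
  "tasep_kernel u = map_pmf (tasep_jump u) (pmf_of_set {..<length u})"

definition tasep_states :: "nat \<Rightarrow> nat list set" where
  "tasep_states N = permutations_of_set {1..N}"

definition tasep_stationary :: "nat \<Rightarrow> nat list pmf \<Rightarrow> bool" where
  "tasep_stationary N \<pi> \<longleftrightarrow>
    set_pmf \<pi> \<subseteq> tasep_states N \<and> bind_pmf \<pi> tasep_kernel = \<pi>"

end

theory Submission imports Defs begin

text \<open>
  For thresholds \<open>t\<^sub>1 < \<dots> < t\<^sub>m\<close> the level sets \<open>{k. u ! k \<le> t\<^sub>i}\<close> of a word jump as one-species
  TASEPs driven by the same bell, so their joint stationary law is that of the Ferrari-Martin
  multi-line queue: start from independent uniform sets of services of sizes \<open>t\<^sub>1, \<dots>, t\<^sub>m\<close> and pass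
  every set through the priority queues below it. With \<open>m = n - 1\<close>, the event
  \<open>u\<^sub>1 > t\<^sub>m \<ge> u\<^sub>2 > t\<^bsub>m-1\<^esub> \<ge> \<dots> \<ge> u\<^sub>m > t\<^sub>1\<close> then says that the first \<open>m\<close> columns of the rows of
  services are prescribed and that all queues are empty when they enter these columns. The remaining
  columns form a family of rows dominating one another in the sense of ballot sequences; these are
  counted by a determinant, removing one column at a time. Finally, the event that the letters are
  exactly \<open>x\<^sub>n, \<dots>, x\<^sub>2\<close> is an alternating sum of such events with thresholds \<open>x\<^sub>i - 1\<close> and \<open>x\<^sub>i\<close>,
  and column operations turn the alternating sum of determinants into the one claimed.
\<close>

section \<open>Queues on the ring\<close>

text \<open>Fixing a letter exactly takes two thresholds, x_i - 1 and x_i, hence twice as many rows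
  as letters. The interlacing events need one threshold per letter, so that each row of the
  prescribed columns can witness an idle service of the row above it. The price is an alternating
  sum, and two facts make it computable. The number of service families, a product of binomials N
  choose t_i, depends on the thresholds; \<open>binomial_cross_identity\<close> trades it for m!
  times the product of N choose 1, ..., N choose m, which does not, so that the sum can be taken
  inside one determinant. And differences in y of (N - y) (y choose j) are triangular in the columns
  y choose j with diagonal j + 1, which produces the m! that cancels. Stationary laws are compared
  on families of sets, not on words: every stationary law of words projects to a stationary law of
  the coupled chain, and uniqueness is proved only there.\<close>

definition jump_left :: "nat \<Rightarrow> nat \<Rightarrow> nat set \<Rightarrow> nat set" where
  "jump_left N i A =
    (if i \<in> A \<and> left_nb N i \<notin> A then insert (left_nb N i) (A - {i}) else A)"

definition right_nb :: "nat \<Rightarrow> nat \<Rightarrow> nat" where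
  "right_nb N i = (if Suc i = N then 0 else Suc i)"

lemma right_nb_less: "i < N \<Longrightarrow> right_nb N i < N"
  by (auto simp: right_nb_def)

lemma left_nb_less: "i < N \<Longrightarrow> left_nb N i < N"
  by (auto simp: left_nb_def)

lemma left_right_nb: "i < N \<Longrightarrow> left_nb N (right_nb N i) = i"
  by (auto simp: left_nb_def right_nb_def)

lemma right_left_nb: "i < N \<Longrightarrow> right_nb N (left_nb N i) = i"
  by (auto simp: left_nb_def right_nb_def)

lemma right_nb_neq: "i < N \<Longrightarrow> N \<ge> 2 \<Longrightarrow> right_nb N i \<noteq> i"
  by (auto simp: right_nb_def)

lemma bij_betw_right_nb: "bij_betw (right_nb N) {..<N} {..<N}"
  by (rule bij_betw_byWitness[where f' = "left_nb N"])
    (auto simp: left_right_nb right_left_nb right_nb_less left_nb_less)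

lemma jump_left_subset: "A \<subseteq> {..<N} \<Longrightarrow> i < N \<Longrightarrow> jump_left N i A \<subseteq> {..<N}"
  using left_nb_less[of i N] by (auto simp: jump_left_def)

lemma card_jump_left:
  assumes "A \<subseteq> {..<N}"
  shows "card (jump_left N i A) = card A"
proof -
  have "finite A" using assms finite_subset by blast
  moreover have "i \<in> A \<Longrightarrow> card A > 0" using \<open>finite A\<close> by (auto simp: card_gt_0_iff)
  ultimately show ?thesis by (auto simp: jump_left_def)
qed

definition netflow :: "nat set \<Rightarrow> nat set \<Rightarrow> nat \<Rightarrow> int" where
  "netflow A S i = of_bool (i \<in> A) - of_bool (i \<in> S)"

lemma sum_of_bool_card:
  fixes N :: nat
  assumes "A \<subseteq> {..<N}"
  shows "(\<Sum>i<N. of_bool (i \<in> A) :: int) = int (card A)"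
proof -
  have "{..<N} \<inter> A = A" using assms by auto
  thus ?thesis by simp
qed

lemma sum_netflow:
  assumes "A \<subseteq> {..<N}" "S \<subseteq> {..<N}"
  shows "(\<Sum>i<N. netflow A S i) = int (card A) - int (card S)"
  unfolding netflow_def sum_subtractf using assms by (simp only: sum_of_bool_card)

section \<open>Queue lengths as solutions of the Lindley recursion on a ring\<close>

definition queue_eq :: "nat \<Rightarrow> nat set \<Rightarrow> nat set \<Rightarrow> (nat \<Rightarrow> int) \<Rightarrow> bool" where
  "queue_eq N A S q \<longleftrightarrow> (\<forall>i<N. q (right_nb N i) = max 0 (q i + netflow A S i))"

lemma queue_eq_nonneg:
  assumes "queue_eq N A S q" "i < N"
  shows "q i \<ge> 0"
  using assms left_nb_less[of i N] right_left_nb[of i N] unfolding queue_eq_def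
  by (metis max.cobounded1)

lemma ring_induct:
  assumes "i0 < N" "P i0" "\<And>i. i < N \<Longrightarrow> P i \<Longrightarrow> P (right_nb N i)" "i < N"
  shows "P i"
proof -
  have up: "P j" if "P k" "k \<le> j" "j < N" for j k
    using that(2,1,3)
  proof (induction j rule: dec_induct)
    case (step n)
    then show ?case using assms(3)[of n] by (auto simp: right_nb_def)
  qed
  have "P (N - 1)" using up[of i0 "N - 1"] assms by auto
  hence "P 0" using assms(3)[of "N - 1"] assms(1) by (auto simp: right_nb_def)
  thus ?thesis using up[of 0 i] assms(4) by auto
qed

text \<open>A positive excess of \<open>q\<close> over \<open>q'\<close> cannot grow along the ring,
  and returning to its start it must be constant. Then \<open>q\<close> exceeds \<open>q'\<close>
  everywhere and is never truncated at 0, so summing its recursion over the ring forces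
  \<open>card A = card S\<close>.\<close>

lemma queue_eq_unique_aux:
  assumes q: "queue_eq N A S q" and q': "queue_eq N A S q'"
    and sub: "A \<subseteq> {..<N}" "S \<subseteq> {..<N}" and card: "card A < card S"
    and i: "i < N"
  shows "q i \<le> q' i"
proof (rule ccontr)
  assume "\<not> q i \<le> q' i"
  define g where "g = (\<lambda>i. q i - q' i)"
  have gi: "g i > 0" using \<open>\<not> q i \<le> q' i\<close> by (simp add: g_def)
  have step: "g (right_nb N j) > 0 \<Longrightarrow> g j \<ge> g (right_nb N j)" if "j < N" for j
    using q q' that unfolding queue_eq_def g_def by (auto simp: max_def split: if_splits)
  have mono: "g j \<ge> 0" if "j < N" for j
  proof (rule ring_induct[of i N "\<lambda>j. g j \<ge> 0"])
    show "\<And>i. i < N \<Longrightarrow> 0 \<le> g i \<Longrightarrow> 0 \<le> g (right_nb N i)"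
      using q q' unfolding queue_eq_def g_def by (auto simp: max_def)
  qed (use i gi that in auto)
  have dec: "g (right_nb N j) \<le> g j" if "j < N" for j
    using step[OF that] mono[OF that] by linarith
  have tot: "(\<Sum>j<N. g (right_nb N j)) = (\<Sum>j<N. g j)"
    by (rule sum.reindex_bij_betw[OF bij_betw_right_nb])
  have eq: "g (right_nb N j) = g j" if "j < N" for j
  proof (rule ccontr)
    assume "g (right_nb N j) \<noteq> g j"
    hence "g (right_nb N j) < g j" using dec[OF that] by simp
    hence "(\<Sum>j<N. g (right_nb N j)) < (\<Sum>j<N. g j)"
      using that dec by (intro sum_strict_mono_ex1) auto
    thus False using tot by simp
  qed
  have pos: "g j > 0" if "j < N" for j
    by (rule ring_induct[of i N "\<lambda>j. g j > 0"]) (use i gi that eq in auto)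
  have "q (right_nb N j) = q j + netflow A S j" if "j < N" for j
    using pos[OF that] eq[OF that] q q' that queue_eq_nonneg[OF q' that]
    unfolding queue_eq_def g_def by (auto simp: max_def split: if_splits)
  hence "(\<Sum>j<N. q (right_nb N j)) = (\<Sum>j<N. q j) + (\<Sum>j<N. netflow A S j)"
    by (simp add: sum.distrib)
  moreover have "(\<Sum>j<N. q (right_nb N j)) = (\<Sum>j<N. q j)"
    by (rule sum.reindex_bij_betw[OF bij_betw_right_nb])
  ultimately show False using card sum_netflow[OF sub] by simp
qed

lemma queue_eq_unique:
  assumes "queue_eq N A S q" "queue_eq N A S q'"
    and "A \<subseteq> {..<N}" "S \<subseteq> {..<N}" "card A < card S" "i < N"
  shows "q i = q' i"
  using queue_eq_unique_aux[OF assms(1,2)] queue_eq_unique_aux[OF assms(2,1)] assms(3-)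
  by (simp add: order_antisym)

text \<open>Loynes' formula: the largest net input of the \<open>l\<close> sites preceding
  \<open>i\<close>. The added \<open>N\<close> keeps the subtraction away from truncation. The full
  round \<open>l = N\<close> is left out; it has negative net input when
  \<open>card A < card S\<close>.\<close>

definition queue :: "nat \<Rightarrow> nat set \<Rightarrow> nat set \<Rightarrow> nat \<Rightarrow> int" where
  "queue N A S i = Max ((\<lambda>l. \<Sum>j\<in>{i + N - l..<i + N}. netflow A S (j mod N)) ` {..<N})"

lemma queue_mod:
  assumes "N > 0"
  shows "queue N A S N = queue N A S 0"
proof -
  have "(\<Sum>j\<in>{N + N - l..<N + N}. netflow A S (j mod N)) =
        (\<Sum>j\<in>{0 + N - l..<0 + N}. netflow A S (j mod N))" if "l < N" for l
  proof -
    have "(\<Sum>j\<in>{N - l + N..<N + N}. netflow A S (j mod N)) =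
          (\<Sum>j\<in>{N - l..<N}. netflow A S ((j + N) mod N))"
      by (rule sum.shift_bounds_nat_ivl)
    moreover have "N - l + N = N + N - l" using that by simp
    ultimately show ?thesis by simp
  qed
  thus ?thesis unfolding queue_def by (intro arg_cong[where f = Max] image_cong) auto
qed

lemma queue_Suc:
  assumes sub: "A \<subseteq> {..<N}" "S \<subseteq> {..<N}" and card: "card A < card S" and i: "i < N"
  shows "queue N A S (Suc i) = max 0 (queue N A S i + netflow A S i)"
proof -
  define f where "f = (\<lambda>i l. \<Sum>j\<in>{i + N - l..<i + N}. netflow A S (j mod N))"
  have N: "N > 0" using i by simp
  have Q: "queue N A S i = Max (f i ` {..<N})" for i by (simp add: queue_def f_def)
  have f0: "f i 0 = 0" for i by (simp add: f_def)
  have fSuc: "f (Suc i) (Suc l) = f i l + netflow A S i" if "l < N" for l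
  proof -
    have "{Suc i + N - Suc l..<Suc i + N} = insert (i + N) {i + N - l..<i + N}"
      using that by auto
    thus ?thesis using i by (simp add: f_def)
  qed
  have "f (Suc i) N = (\<Sum>j<N. netflow A S j)"
  proof -
    have "(\<Sum>j\<in>{Suc i..<Suc i + N}. netflow A S (j mod N)) = (\<Sum>j<N. netflow A S j)"
    proof (rule sum.reindex_bij_betw[of "\<lambda>j. j mod N"])
      have "inj_on (\<lambda>j. j mod N) {Suc i..<Suc i + N}"
      proof (rule inj_onI)
        fix x y assume *: "x \<in> {Suc i..<Suc i + N}" "y \<in> {Suc i..<Suc i + N}" "x mod N = y mod N"
        have "int x mod int N = int y mod int N" using *(3) by (metis of_nat_mod)
        hence "int N dvd int x - int y" by (rule mod_eq_dvd_iff[THEN iffD1])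
        moreover have "\<bar>int x - int y\<bar> < int N" using *(1,2) by auto
        ultimately show "x = y" using zdvd_not_zless
          by (smt (verit) dvd_minus_iff of_nat_eq_iff)
      qed
      moreover from this have "(\<lambda>j. j mod N) ` {Suc i..<Suc i + N} = {..<N}"
        using N by (intro card_subset_eq) (auto simp: card_image)
      ultimately show "bij_betw (\<lambda>j. j mod N) {Suc i..<Suc i + N} {..<N}"
        by (simp add: bij_betw_def)
    qed
    thus ?thesis by (simp only: f_def add_diff_cancel_right')
  qed
  \<comment> \<open>Extending all windows by one site creates one of length \<open>N\<close>. It
    loses against the empty window, so the maximum may again run over lengths below
    \<open>N\<close>.\<close>
  hence neg: "f (Suc i) N < 0" using sum_netflow[OF sub] card by simp
  have "max 0 (queue N A S i + netflow A S i) = max 0 (Max ((\<lambda>l. f i l + netflow A S i) ` {..<N}))"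
    unfolding Q using N by (subst Max_add_commute[symmetric]) auto
  also have "(\<lambda>l. f i l + netflow A S i) ` {..<N} = f (Suc i) ` {1..N}"
  proof -
    have "{1..N} = Suc ` {..<N}" by (simp add: image_Suc_lessThan)
    thus ?thesis by (simp add: image_image fSuc)
  qed
  also have "max 0 (Max (f (Suc i) ` {1..N})) = Max (insert (f (Suc i) 0) (f (Suc i) ` {1..N}))"
    using N by (subst Max_insert) (auto simp: f0)
  also have "\<dots> = Max (f (Suc i) ` {..<N})"
  proof (rule antisym)
    have "f (Suc i) l \<le> Max (f (Suc i) ` {..<N})" if "l \<le> N" for l
    proof (cases "l = N")
      case True
      have "f (Suc i) N \<le> f (Suc i) 0" using neg f0 by simp
      also have "\<dots> \<le> Max (f (Suc i) ` {..<N})" using N by (intro Max_ge) auto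
      finally show ?thesis using True by simp
    qed (use that in \<open>auto intro!: Max_ge\<close>)
    thus "Max (insert (f (Suc i) 0) (f (Suc i) ` {1..N})) \<le> Max (f (Suc i) ` {..<N})"
      by (intro Max.boundedI) auto
    have "f (Suc i) ` {..<N} \<subseteq> insert (f (Suc i) 0) (f (Suc i) ` {1..N})"
    proof
      fix y assume "y \<in> f (Suc i) ` {..<N}"
      then obtain l where "l < N" "y = f (Suc i) l" by auto
      thus "y \<in> insert (f (Suc i) 0) (f (Suc i) ` {1..N})" by (cases l) auto
    qed
    thus "Max (f (Suc i) ` {..<N}) \<le> Max (insert (f (Suc i) 0) (f (Suc i) ` {1..N}))"
      using N by (intro Max_mono) auto
  qed
  finally show ?thesis by (simp add: Q)
qed

lemma queue_eq_queue:
  assumes "A \<subseteq> {..<N}" "S \<subseteq> {..<N}" "card A < card S"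
  shows "queue_eq N A S (queue N A S)"
  using queue_Suc[OF assms] queue_mod[of N A S] unfolding queue_eq_def right_nb_def by auto

lemma queue_mono:
  assumes "A \<subseteq> B"
  shows "queue N A S i \<le> queue N B S i"
proof (cases "N = 0")
  case False
  have "(\<Sum>j\<in>{i + N - l..<i + N}. netflow A S (j mod N)) \<le> queue N B S i" if "l < N" for l
  proof -
    have "(\<Sum>j\<in>{i + N - l..<i + N}. netflow A S (j mod N)) \<le>
          (\<Sum>j\<in>{i + N - l..<i + N}. netflow B S (j mod N))"
      using assms by (intro sum_mono) (auto simp: netflow_def)
    also have "\<dots> \<le> queue N B S i" unfolding queue_def using that by (intro Max_ge) auto
    finally show ?thesis .
  qed
  thus ?thesis unfolding queue_def[of N A] using False by (intro Max.boundedI) auto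
qed (simp add: queue_def)

text \<open>The windows that end just before site 0 are the suffixes of the ring cut open at 0, so
  Loynes' formula becomes a ballot condition read from the right end.\<close>

lemma queue_0_eq_0_iff:
  assumes "A \<subseteq> {..<N}" "S \<subseteq> {..<N}" "card A < card S"
  shows "queue N A S 0 = 0 \<longleftrightarrow> (\<forall>c\<le>N. card (A \<inter> {c..<N}) \<le> card (S \<inter> {c..<N}))"
proof -
  have N: "N > 0" using assms(2,3) by (cases N) auto
  have eq: "sum (netflow A S) {c..<N} =
        int (card (A \<inter> {c..<N})) - int (card (S \<inter> {c..<N}))" for c
    by (simp add: netflow_def sum_subtractf of_bool_def sum.If_cases Int_def conj_commute)
  have "queue N A S 0 = 0 \<longleftrightarrow> queue N A S 0 \<le> 0"
    using queue_eq_nonneg[OF queue_eq_queue[OF assms] N] by auto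
  also have "\<dots> \<longleftrightarrow> (\<forall>l<N. (\<Sum>j\<in>{N - l..<N}. netflow A S (j mod N)) \<le> 0)"
    unfolding queue_def using N by (subst Max_le_iff) auto
  also have "\<dots> \<longleftrightarrow> (\<forall>l<N. card (A \<inter> {N - l..<N}) \<le> card (S \<inter> {N - l..<N}))"
    by (simp add: eq)
  also have "\<dots> \<longleftrightarrow> (\<forall>c\<le>N. card (A \<inter> {c..<N}) \<le> card (S \<inter> {c..<N}))"
  proof safe
    fix c assume *: "\<forall>l<N. card (A \<inter> {N - l..<N}) \<le> card (S \<inter> {N - l..<N})" "c \<le> N"
    show "card (A \<inter> {c..<N}) \<le> card (S \<inter> {c..<N})"
    proof (cases "c = 0")
      case True
      \<comment> \<open>The suffix \<open>c = 0\<close> is the full round, which the maximum does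
        not cover.\<close>
      have "A \<inter> {0..<N} = A" "S \<inter> {0..<N} = S" using assms by auto
      thus ?thesis using True assms(3) by simp
    next
      case False
      thus ?thesis using *(1)[rule_format, of "N - c"] *(2) N by simp
    qed
  qed auto
  finally show ?thesis .
qed

definition departures :: "nat \<Rightarrow> nat set \<Rightarrow> nat set \<Rightarrow> nat set" where
  "departures N A S = {i \<in> S. i \<in> A \<or> queue N A S i > 0}"

lemma departures_subset: "departures N A S \<subseteq> S"
  by (auto simp: departures_def)

lemma departures_eqI:
  assumes "queue_eq N A S q" "A \<subseteq> {..<N}" "S \<subseteq> {..<N}" "card A < card S"
  shows "departures N A S = {i \<in> S. i \<in> A \<or> q i > 0}"
  using queue_eq_unique[OF assms(1) queue_eq_queue[OF assms(2-4)] assms(2-4)] assms(3)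
  by (auto simp: departures_def)

text \<open>Queue lengths return to their values after one round, so the total flow in equals the
  total flow out.\<close>

lemma card_departures:
  assumes sub: "A \<subseteq> {..<N}" "S \<subseteq> {..<N}" and card: "card A < card S"
  shows "card (departures N A S) = card A"
proof -
  let ?q = "queue N A S" and ?D = "departures N A S"
  note qe = queue_eq_queue[OF assms]
  have "?q (right_nb N j) = ?q j + of_bool (j \<in> A) - of_bool (j \<in> ?D)" if "j < N" for j
    using qe that queue_eq_nonneg[OF qe that]
    unfolding queue_eq_def departures_def netflow_def by (auto simp: max_def)
  hence "(\<Sum>j<N. ?q (right_nb N j)) =
      (\<Sum>j<N. ?q j) + (\<Sum>j<N. of_bool (j \<in> A)) - (\<Sum>j<N. of_bool (j \<in> ?D))"
    by (simp add: sum.distrib sum_subtractf)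
  moreover have "(\<Sum>j<N. ?q (right_nb N j)) = (\<Sum>j<N. ?q j)"
    by (rule sum.reindex_bij_betw[OF bij_betw_right_nb])
  moreover have "?D \<subseteq> {..<N}" using departures_subset sub by blast
  ultimately show ?thesis using sum_of_bool_card[OF sub(1)] sum_of_bool_card[of ?D N] by simp
qed

section \<open>Departures commute with jumps\<close>

definition bell :: "nat \<Rightarrow> nat set \<Rightarrow> nat \<Rightarrow> nat" where
  "bell N S i = (if i \<in> S then i else right_nb N i)"

lemma bell_less: "i < N \<Longrightarrow> bell N S i < N"
  by (simp add: bell_def right_nb_less)

text \<open>With a service at \<open>i\<close>, arrivals and services hear the same bell. Without
  one, the departures must not change: an arrival that jumps from the right neighbour to
  \<open>i\<close> finds no service there and waits for the site it came from, where it meets the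
  same service as before.\<close>

lemma departures_jump_left:
  assumes sub: "A \<subseteq> {..<N}" "S \<subseteq> {..<N}" and card: "card A < card S" and i: "i < N"
  shows "departures N (jump_left N (bell N S i) A) (jump_left N i S) =
         jump_left N i (departures N A S)"
proof (cases "N \<ge> 2")
  case False
  \<comment> \<open>On a one-site ring \<open>l\<close> and \<open>k\<close> below would coincide,
    but nothing can move.\<close>
  hence "N = 1" using i by simp
  hence "left_nb N i = i" "right_nb N i = i" using i by (auto simp: left_nb_def right_nb_def)
  thus ?thesis by (auto simp: jump_left_def bell_def)
next
  case True
  let ?q = "queue N A S"
  define k where "k = bell N S i"
  define l where "l = left_nb N k"
  define A' where "A' = jump_left N k A"
  define S' where "S' = jump_left N i S"
  \<comment> \<open>Only the sites \<open>l\<close> and \<open>k\<close> are touched and the queue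
    leaving \<open>k\<close> is unchanged, so the new solution of the recursion differs from the old
    one at most at \<open>k\<close>. Uniqueness then identifies it with the new queue.\<close>
  define q' where "q' = ?q(k := max 0 (?q l + netflow A' S' l))"
  have k: "k < N" "l < N" "right_nb N l = k"
    using i by (auto simp: k_def l_def bell_less left_nb_less right_left_nb)
  have lk: "l \<noteq> k" using k True right_nb_neq by metis
  have sub': "A' \<subseteq> {..<N}" "S' \<subseteq> {..<N}"
    using jump_left_subset sub i k(1) by (auto simp: A'_def S'_def)
  have card': "card A' < card S'"
    using card card_jump_left sub by (simp add: A'_def S'_def)
  have A': "j \<in> A' \<longleftrightarrow> (if j = l then l \<in> A \<or> k \<in> A else if j = k then k \<in> A \<and> l \<in> A else j \<in> A)"
    for j using lk by (auto simp: A'_def jump_left_def l_def[symmetric])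
  have S': "j \<in> S' \<longleftrightarrow> (if i \<notin> S then j \<in> S else
      if j = l then True else if j = k then l \<in> S else j \<in> S)" for j
    using lk by (auto simp: S'_def jump_left_def k_def l_def bell_def)
  have iS: "i \<in> S \<Longrightarrow> k = i" "i \<notin> S \<Longrightarrow> l = i"
    using i by (auto simp: k_def l_def bell_def left_right_nb)
  have kS: "i \<in> S \<Longrightarrow> k \<in> S" and lS: "i \<notin> S \<Longrightarrow> l \<notin> S"
    using iS by auto
  note qe = queue_eq_queue[OF sub card]
  have rec: "?q (right_nb N j) = max 0 (?q j + netflow A S j)" if "j < N" for j
    using qe that by (auto simp: queue_eq_def)
  have ql: "?q k = max 0 (?q l + netflow A S l)" using rec[OF k(2)] k(3) by simp
  have nonneg: "?q j \<ge> 0" if "j < N" for j using queue_eq_nonneg[OF qe that] .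
  have qe': "queue_eq N A' S' q'"
    unfolding queue_eq_def
  proof (intro allI impI)
    fix j assume j: "j < N"
    consider "j = l" | "j = k" | "j \<noteq> l" "j \<noteq> k" by blast
    thus "q' (right_nb N j) = max 0 (q' j + netflow A' S' j)"
    proof cases
      case 1
      thus ?thesis using lk k(3) by (simp add: q'_def)
    next
      case 2
      have "right_nb N k \<noteq> k" using k(1) True right_nb_neq by blast
      thus ?thesis
        using lk nonneg[OF k(2)] kS lS ql rec[OF k(1)] unfolding 2
        by (cases "i \<in> S"; cases "l \<in> S"; cases "l \<in> A"; cases "k \<in> A")
          (simp_all add: q'_def netflow_def A' S' max_def split: if_splits)
    next
      case 3
      hence "right_nb N j \<noteq> k" using j k left_right_nb by metis
      thus ?thesis using 3 rec[OF j] by (simp add: q'_def netflow_def A' S')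
    qed
  qed
  have D': "departures N A' S' = {j \<in> S'. j \<in> A' \<or> q' j > 0}"
    by (rule departures_eqI[OF qe' sub' card'])
  have Dm: "j \<in> departures N A S \<longleftrightarrow> j \<in> S \<and> (j \<in> A \<or> ?q j > 0)" for j
    by (simp add: departures_def)
  have J: "j \<in> jump_left N i (departures N A S) \<longleftrightarrow>
      (if i \<notin> S then j \<in> departures N A S
       else if j = l then l \<in> departures N A S \<or> k \<in> departures N A S
       else if j = k then l \<in> departures N A S \<and> k \<in> departures N A S
       else j \<in> departures N A S)" for j
  proof (cases "i \<in> S")
    case True
    hence "i = k" "left_nb N k = l" using iS by (auto simp: l_def)
    thus ?thesis using lk True by (auto simp: jump_left_def)
  next
    case False
    hence "i \<notin> departures N A S" by (simp add: Dm)
    thus ?thesis using False by (simp add: jump_left_def)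
  qed
  show ?thesis
    unfolding k_def[symmetric] A'_def[symmetric] S'_def[symmetric]
  proof (rule Set.set_eqI)
    fix j
    consider "j = l" | "j = k" | "j \<noteq> l" "j \<noteq> k" by blast
    thus "j \<in> departures N A' S' \<longleftrightarrow> j \<in> jump_left N i (departures N A S)"
    proof cases
      case 1
      show ?thesis using lk nonneg[OF k(2)] kS lS ql
        unfolding D' J Dm 1
        by (cases "i \<in> S"; cases "l \<in> S"; cases "l \<in> A"; cases "k \<in> A")
          (simp_all add: q'_def netflow_def A' S' max_def split: if_splits)
    next
      case 2
      show ?thesis using lk nonneg[OF k(2)] kS lS ql
        unfolding D' J Dm 2
        by (cases "i \<in> S"; cases "l \<in> S"; cases "l \<in> A"; cases "k \<in> A")
          (simp_all add: q'_def netflow_def A' S' max_def split: if_splits)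
    next
      case 3
      thus ?thesis unfolding D' J Dm by (auto simp: q'_def A' S')
    qed
  qed
qed

definition subsets_of_card :: "nat \<Rightarrow> nat \<Rightarrow> nat set set" where
  "subsets_of_card N s = {S. S \<subseteq> {..<N} \<and> card S = s}"

lemma finite_subsets_of_card: "finite (subsets_of_card N s)"
  by (rule finite_subset[of _ "Pow {..<N}"]) (auto simp: subsets_of_card_def)

lemma card_subsets_of_card: "card (subsets_of_card N s) = N choose s"
  using n_subsets[of "{..<N}" s] by (simp add: subsets_of_card_def)

lemma bij_betw_jump_bell:
  "bij_betw (\<lambda>(S, i). (jump_left N i S, bell N S i))
    (subsets_of_card N s \<times> {..<N}) (subsets_of_card N s \<times> {..<N})"
proof -
  let ?f = "\<lambda>(S, i). (jump_left N i S, bell N S i)"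
  let ?X = "subsets_of_card N s \<times> {..<N}"
  \<comment> \<open>The left neighbour of the new bell tells the cases apart: it is occupied if
    there was a service at \<open>i\<close>, whether this jumped or was blocked, and it is the empty
    site \<open>i\<close> if the bell was passed to the right.\<close>
  define g where "g = (\<lambda>(S, k). if left_nb N k \<in> S
    then (if k \<in> S then S else insert k (S - {left_nb N k}), k) else (S, left_nb N k))"
  have "g (?f p) = p" if pX: "p \<in> ?X" for p
  proof -
    obtain S i where p: "p = (S, i)" "i < N" by (cases p) (use pX in auto)
    have "left_nb N (right_nb N i) = i" using left_right_nb p by simp
    thus ?thesis by (auto simp: p g_def jump_left_def bell_def)
  qed
  hence inj: "inj_on ?f ?X" by (rule inj_on_inverseI)
  have "?f ` ?X \<subseteq> ?X"
    using jump_left_subset card_jump_left bell_less by (auto simp: subsets_of_card_def)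
  hence "?f ` ?X = ?X"
    using inj by (intro endo_inj_surj) (auto simp: finite_subsets_of_card)
  thus ?thesis using inj by (simp add: bij_betw_def)
qed

section \<open>Tandem queues\<close>

definition multi_jump :: "nat \<Rightarrow> nat set list \<Rightarrow> nat set list pmf" where
  "multi_jump N As = map_pmf (\<lambda>i. map (jump_left N i) As) (pmf_of_set {..<N})"

text \<open>The head is the last queue. Priorities need no bookkeeping: customers of the first few
  classes together form an ordinary one-class queue, so the same services act on each cumulated set
  separately.\<close>

fun tandem :: "nat \<Rightarrow> nat set list \<Rightarrow> nat set list" where
  "tandem N [] = []"
| "tandem N (S # Ss) = S # map (\<lambda>A. departures N A S) (tandem N Ss)"

text \<open>Only the sizes are prescribed and the sets need not be nested: the space has to contain
  independent rows of services as well as level sets of words.\<close>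

definition profiles :: "nat \<Rightarrow> nat list \<Rightarrow> nat set list set" where
  "profiles N ts = {Ss. list_all2 (\<lambda>S t. S \<in> subsets_of_card N t) Ss ts}"

lemma profiles_Nil: "profiles N [] = {[]}"
  by (auto simp: profiles_def)

lemma profiles_Cons: "profiles N (t # ts) = (\<lambda>(S, Ss). S # Ss) ` (subsets_of_card N t \<times> profiles N ts)"
  by (auto simp: profiles_def list_all2_Cons2)

lemma finite_profiles: "finite (profiles N ts)"
  by (induction ts) (auto simp: profiles_Nil profiles_Cons finite_subsets_of_card)

lemma card_profiles: "card (profiles N ts) = (\<Prod>t\<leftarrow>ts. N choose t)"
proof (induction ts)
  case (Cons t ts)
  have "inj_on (\<lambda>(S, Ss). S # Ss) (subsets_of_card N t \<times> profiles N ts)" by (auto intro: inj_onI)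
  thus ?case using Cons by (simp add: profiles_Cons card_image card_cartesian_product card_subsets_of_card)
qed (simp add: profiles_Nil)

lemma subsets_of_card_nonempty: "t \<le> N \<Longrightarrow> subsets_of_card N t \<noteq> {}"
  using card_subsets_of_card[of N t] by (metis binomial_eq_0_iff card.empty not_less)

lemma profiles_nonempty: "\<forall>t\<in>set ts. t \<le> N \<Longrightarrow> profiles N ts \<noteq> {}"
  by (induction ts) (auto simp: profiles_Nil profiles_Cons subsets_of_card_nonempty)

lemma tandem_profiles:
  assumes "Ss \<in> profiles N ts" "sorted_wrt (>) ts"
  shows "tandem N Ss \<in> profiles N ts"
  using assms
proof (induction ts arbitrary: Ss)
  case (Cons t ts)
  then obtain S Ss' where Ss: "Ss = S # Ss'" "S \<in> subsets_of_card N t" "Ss' \<in> profiles N ts"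
    by (auto simp: profiles_Cons)
  have IH: "list_all2 (\<lambda>S t. S \<in> subsets_of_card N t) (tandem N Ss') ts"
    using Cons Ss by (simp add: profiles_def)
  have "list_all2 (\<lambda>A t. departures N A S \<in> subsets_of_card N t) (tandem N Ss') ts"
  proof (rule list.rel_mono_strong[OF IH])
    fix A u assume *: "A \<in> set (tandem N Ss')" "u \<in> set ts" "A \<in> subsets_of_card N u"
    hence "u < t" using Cons.prems(2) by simp
    thus "departures N A S \<in> subsets_of_card N u"
      using * Ss(2) card_departures[of A N S] departures_subset[of N A S]
      by (auto simp: subsets_of_card_def)
  qed
  thus ?case using Ss by (simp add: profiles_def list.rel_map)
qed (simp add: profiles_Nil)

lemma profiles_member:
  assumes "As \<in> profiles N ts" "A \<in> set As"
  shows "\<exists>t\<in>set ts. A \<in> subsets_of_card N t"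
  using assms unfolding profiles_def
  by (metis list_all2_conv_all_nth in_set_conv_nth mem_Collect_eq)

lemma profiles_jump_left:
  assumes "As \<in> profiles N ts" "i < N"
  shows "map (jump_left N i) As \<in> profiles N ts"
proof -
  have "jump_left N i A \<in> subsets_of_card N t" if "A \<in> subsets_of_card N t" for A t
    using that assms(2) jump_left_subset[of A N i] card_jump_left[of A N i]
    by (simp add: subsets_of_card_def)
  thus ?thesis using assms(1) unfolding profiles_def list_all2_map1 mem_Collect_eq
    by (auto elim: list_all2_mono)
qed

lemma pmf_of_set_Times:
  assumes "finite A" "A \<noteq> {}" "finite B" "B \<noteq> {}"
  shows "pmf_of_set (A \<times> B) = pair_pmf (pmf_of_set A) (pmf_of_set B)"
proof (rule pmf_eqI)
  fix p
  show "pmf (pmf_of_set (A \<times> B)) p = pmf (pair_pmf (pmf_of_set A) (pmf_of_set B)) p"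
    using assms by (cases p) (simp add: pmf_pair indicator_def card_cartesian_product)
qed

definition tandem_law :: "nat \<Rightarrow> nat list \<Rightarrow> nat set list pmf" where
  "tandem_law N ts = map_pmf (tandem N) (pmf_of_set (profiles N ts))"

lemma set_tandem_law:
  assumes "sorted_wrt (>) ts" "\<forall>t\<in>set ts. t \<le> N"
  shows "set_pmf (tandem_law N ts) \<subseteq> profiles N ts"
  using tandem_profiles[OF _ assms(1)] profiles_nonempty[OF assms(2)] finite_profiles
  by (auto simp: tandem_law_def)

lemma tandem_law_Nil: "tandem_law N [] = return_pmf []"
  by (simp add: tandem_law_def profiles_Nil pmf_of_set_singleton)

lemma tandem_law_Cons:
  assumes "\<forall>u\<in>set (t # ts). u \<le> N"
  shows "tandem_law N (t # ts) = bind_pmf (pmf_of_set (subsets_of_card N t)) (\<lambda>S.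
    map_pmf (\<lambda>As. S # map (\<lambda>A. departures N A S) As) (tandem_law N ts))"
proof -
  have ne: "subsets_of_card N t \<noteq> {}" "profiles N ts \<noteq> {}"
    using assms by (auto simp: subsets_of_card_nonempty profiles_nonempty)
  have "pmf_of_set (profiles N (t # ts)) = map_pmf (\<lambda>(S, Ss). S # Ss)
      (pmf_of_set (subsets_of_card N t \<times> profiles N ts))"
    unfolding profiles_Cons using ne
    by (subst map_pmf_of_set_inj) (auto intro: inj_onI simp: finite_subsets_of_card finite_profiles)
  also have "pmf_of_set (subsets_of_card N t \<times> profiles N ts) =
      pair_pmf (pmf_of_set (subsets_of_card N t)) (pmf_of_set (profiles N ts))"
    by (rule pmf_of_set_Times) (use ne finite_subsets_of_card finite_profiles in auto)
  finally show ?thesis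
    by (simp add: tandem_law_def pair_pmf_def map_bind_pmf bind_map_pmf map_pmf_def
        bind_assoc_pmf bind_return_pmf)
qed

text \<open>Serving at time \<open>i\<close> and ringing the induced bell for the arrivals commute with taking
  departures. Since \<open>(S, i) \<mapsto> (S', i')\<close> permutes the pairs, the new services \<open>S'\<close> are again uniform
  and independent of the bell \<open>i'\<close>, hence of the updated arrivals.\<close>

lemma tandem_law_stationary:
  assumes "sorted_wrt (>) ts" "\<forall>t\<in>set ts. t \<le> N" "N > 0"
  shows "bind_pmf (tandem_law N ts) (multi_jump N) = tandem_law N ts"
  using assms(1,2)
proof (induction ts)
  case Nil
  show ?case by (simp add: tandem_law_Nil bind_return_pmf multi_jump_def map_pmf_const)
next
  case (Cons t ts)
  let ?U = "pmf_of_set (subsets_of_card N t)" and ?I = "pmf_of_set {..<N}"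
  let ?L = "tandem_law N ts"
  let ?X = "subsets_of_card N t \<times> {..<N}"
  define f where "f = (\<lambda>(S, i). (jump_left N i S, bell N S i))"
  define h where "h = (\<lambda>(S, k). map_pmf (\<lambda>As. S # map (\<lambda>A. departures N (jump_left N k A) S) As) ?L)"
  have IH: "bind_pmf ?L (multi_jump N) = ?L" using Cons by auto
  have neU: "subsets_of_card N t \<noteq> {}" using Cons.prems by (auto simp: subsets_of_card_nonempty)
  have neI: "{..<N} \<noteq> {}" using assms(3) by auto
  note fin = finite_subsets_of_card[of N t]
  have pX: "pmf_of_set ?X = pair_pmf ?U ?I"
    by (rule pmf_of_set_Times) (use fin neU neI in auto)
  have fX: "map_pmf f (pmf_of_set ?X) = pmf_of_set ?X"
    unfolding f_def using neU neI fin
    by (intro map_pmf_of_set_bij_betw[OF bij_betw_jump_bell]) auto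
  have law: "tandem_law N (t # ts) =
      bind_pmf ?U (\<lambda>S. map_pmf (\<lambda>As. S # map (\<lambda>A. departures N A S) As) ?L)"
    by (rule tandem_law_Cons) (use Cons.prems in auto)
  have h: "h (f (S, i)) = map_pmf (\<lambda>As. map (jump_left N i) (S # map (\<lambda>A. departures N A S) As)) ?L"
    if S: "S \<in> subsets_of_card N t" and i: "i < N" for S i
    unfolding h_def f_def split
  proof (rule map_pmf_cong[OF refl])
    fix As assume "As \<in> set_pmf ?L"
    hence "As \<in> profiles N ts" using set_tandem_law[of ts N] Cons.prems by auto
    note As = profiles_member[OF this]
    have "departures N (jump_left N (bell N S i) A) (jump_left N i S) =
        jump_left N i (departures N A S)" if "A \<in> set As" for A
      using As[OF that] S i Cons.prems(1)
      by (intro departures_jump_left) (auto simp: subsets_of_card_def)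
    thus "jump_left N i S # map (\<lambda>A. departures N (jump_left N (bell N S i) A) (jump_left N i S)) As =
        map (jump_left N i) (S # map (\<lambda>A. departures N A S) As)"
      by simp
  qed
  have "bind_pmf (tandem_law N (t # ts)) (multi_jump N) =
      bind_pmf ?U (\<lambda>S. bind_pmf ?L (\<lambda>As. bind_pmf ?I (\<lambda>i.
        return_pmf (map (jump_left N i) (S # map (\<lambda>A. departures N A S) As)))))"
    unfolding law multi_jump_def map_pmf_def by (simp add: bind_assoc_pmf bind_return_pmf)
  also have "\<dots> = bind_pmf ?U (\<lambda>S. bind_pmf ?I (\<lambda>i.
        map_pmf (\<lambda>As. map (jump_left N i) (S # map (\<lambda>A. departures N A S) As)) ?L))"
    unfolding map_pmf_def by (subst bind_commute_pmf) (rule refl)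
  also have "\<dots> = bind_pmf ?U (\<lambda>S. bind_pmf ?I (\<lambda>i. h (f (S, i))))"
    using h fin neU neI by (intro bind_pmf_cong refl) auto
  also have "\<dots> = bind_pmf (map_pmf f (pmf_of_set ?X)) h"
    unfolding pX by (simp add: pair_pmf_def bind_map_pmf bind_assoc_pmf bind_return_pmf)
  also have "\<dots> = bind_pmf ?U (\<lambda>S. bind_pmf ?I (\<lambda>k. h (S, k)))"
    unfolding fX unfolding pX by (simp add: pair_pmf_def bind_assoc_pmf bind_return_pmf)
  \<comment> \<open>The bell \<open>k\<close> is independent of the services and of the arrivals, so
    ringing it is one step of the chain of arrivals, to which the induction hypothesis
    applies.\<close>
  also have "\<dots> = bind_pmf ?U (\<lambda>S. bind_pmf (bind_pmf ?L (multi_jump N)) (\<lambda>As.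
      return_pmf (S # map (\<lambda>A. departures N A S) As)))"
    unfolding h_def split multi_jump_def map_pmf_def
    by (subst bind_commute_pmf) (simp add: bind_assoc_pmf bind_return_pmf o_def)
  also have "\<dots> = tandem_law N (t # ts)"
    unfolding IH law map_pmf_def ..
  finally show ?case .
qed

section \<open>Uniqueness of the stationary law\<close>

text \<open>The positive part \<open>d\<close> of the difference is dominated by its image under
  \<open>K\<close>. Both have the same total mass on \<open>X\<close>, hence they are equal, and the
  mass of \<open>d\<close> at \<open>x\<close> reaches \<open>y\<close>.\<close>

lemma stationary_le_aux:
  fixes K :: "'a \<Rightarrow> 'a pmf"
  assumes X: "finite X" "set_pmf p \<subseteq> X" "set_pmf q \<subseteq> X" "\<And>x. x \<in> X \<Longrightarrow> set_pmf (K x) \<subseteq> X"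
    and p: "bind_pmf p K = p" and q: "bind_pmf q K = q"
    and xy: "x \<in> X" "y \<in> set_pmf (K x)" and pos: "pmf p x > pmf q x"
  shows "pmf p y > pmf q y"
proof -
  define d where "d = (\<lambda>x. max 0 (pmf p x - pmf q x))"
  have bal: "pmf r y = (\<Sum>x\<in>X. pmf r x * pmf (K x) y)"
    if "set_pmf r \<subseteq> X" "bind_pmf r K = r" for r y
  proof -
    have "pmf r y = pmf (bind_pmf r K) y" using that(2) by simp
    also have "\<dots> = (\<Sum>x\<in>X. pmf (K x) y * pmf r x)"
      unfolding pmf_bind using that(1) X(1) by (intro integral_measure_pmf_real) auto
    finally show ?thesis by (simp add: mult.commute)
  qed
  have le: "d y \<le> (\<Sum>x\<in>X. d x * pmf (K x) y)" for y
  proof -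
    have "pmf p y - pmf q y = (\<Sum>x\<in>X. (pmf p x - pmf q x) * pmf (K x) y)"
      using bal[OF X(2) p, of y] bal[OF X(3) q, of y] by (simp add: sum_subtractf left_diff_distrib)
    also have "\<dots> \<le> (\<Sum>x\<in>X. d x * pmf (K x) y)"
      by (intro sum_mono mult_right_mono) (auto simp: d_def)
    finally show ?thesis by (auto simp: d_def intro!: sum_nonneg)
  qed
  have "(\<Sum>y\<in>X. \<Sum>x\<in>X. d x * pmf (K x) y) = (\<Sum>x\<in>X. d x * (\<Sum>y\<in>X. pmf (K x) y))"
    by (subst sum.swap) (simp add: sum_distrib_left)
  also have "\<dots> = (\<Sum>x\<in>X. d x)"
    using X(1,4) by (intro sum.cong refl) (simp add: sum_pmf_eq_1)
  finally have tot: "(\<Sum>y\<in>X. \<Sum>x\<in>X. d x * pmf (K x) y) = (\<Sum>y\<in>X. d y)" .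
  have y: "y \<in> X" using X(4) xy by auto
  have eq: "d y = (\<Sum>x\<in>X. d x * pmf (K x) y)"
  proof (rule ccontr)
    assume "d y \<noteq> (\<Sum>x\<in>X. d x * pmf (K x) y)"
    hence "d y < (\<Sum>x\<in>X. d x * pmf (K x) y)" using le[of y] by simp
    hence "(\<Sum>y\<in>X. d y) < (\<Sum>y\<in>X. \<Sum>x\<in>X. d x * pmf (K x) y)"
      using le y X(1) by (intro sum_strict_mono_ex1) auto
    thus False using tot by simp
  qed
  have "0 < d x * pmf (K x) y"
    using pos xy(2) by (simp add: d_def pmf_positive)
  also have "\<dots> \<le> (\<Sum>x\<in>X. d x * pmf (K x) y)"
    using xy(1) X(1) by (intro member_le_sum) (auto simp: d_def)
  finally show ?thesis using eq by (simp add: d_def max_def split: if_splits)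
qed

text \<open>The positive part of the difference of two stationary laws is itself invariant, so it charges
  every state reachable from its support; a commonly reachable state would thus be charged more by
  each of the two laws than by the other.\<close>

lemma stationary_unique:
  fixes K :: "'a \<Rightarrow> 'a pmf"
  assumes X: "finite X" "set_pmf p \<subseteq> X" "set_pmf q \<subseteq> X" "\<And>x. x \<in> X \<Longrightarrow> set_pmf (K x) \<subseteq> X"
    and p: "bind_pmf p K = p" and q: "bind_pmf q K = q"
    and z: "\<And>x. x \<in> X \<Longrightarrow> (x, z) \<in> {(x, y). y \<in> set_pmf (K x)}\<^sup>*"
  shows "p = q"
proof (rule ccontr)
  assume "p \<noteq> q"
  have gt: "pmf r' z < pmf r z"
    if r: "set_pmf r \<subseteq> X" "bind_pmf r K = r" and r': "set_pmf r' \<subseteq> X" "bind_pmf r' K = r'"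
      and "r \<noteq> r'" for r r'
  proof -
    have "\<exists>x\<in>X. pmf r' x < pmf r x"
    proof (rule ccontr)
      assume "\<not> ?thesis"
      hence le: "pmf r x \<le> pmf r' x" if "x \<in> X" for x using that by force
      have "(\<Sum>x\<in>X. pmf r x) = (\<Sum>x\<in>X. pmf r' x)"
        using X(1) r(1) r'(1) by (simp add: sum_pmf_eq_1)
      hence eq: "pmf r x = pmf r' x" if "x \<in> X" for x
        using sum_mono_inv[of "pmf r" X "pmf r'" x] le that X(1) by auto
      have "pmf r x = pmf r' x" for x
        using eq[of x] r(1) r'(1) set_pmf_iff[of x r] set_pmf_iff[of x r'] by (cases "x \<in> X") auto
      thus False using \<open>r \<noteq> r'\<close> by (auto intro: pmf_eqI)
    qed
    then obtain x where x: "x \<in> X" "pmf r' x < pmf r x" by blast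
    from z[OF x(1)] show ?thesis using x
    proof (induction rule: converse_rtrancl_induct)
      case (step x y)
      hence y: "y \<in> set_pmf (K x)" by simp
      have "pmf r' y < pmf r y"
        by (rule stationary_le_aux[OF X(1) r(1) r'(1) X(4) r(2) r'(2) step.prems(1) y step.prems(2)])
      moreover have "y \<in> X" using y X(4) step.prems(1) by blast
      ultimately show ?case using step.IH by blast
    qed
  qed
  show False using gt[OF X(2) p X(3) q] gt[OF X(3) q X(2) p] \<open>p \<noteq> q\<close> by auto
qed

section \<open>Every family of sets can be sorted to the left\<close>

lemma sum_jump_left:
  assumes "finite A"
  shows "\<Sum>(jump_left N (Suc i) A) \<le> \<Sum>A"
    and "Suc i \<in> A \<Longrightarrow> i \<notin> A \<Longrightarrow> \<Sum>(jump_left N (Suc i) A) < \<Sum>A"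
proof -
  have *: "\<Sum>(jump_left N (Suc i) A) < \<Sum>A" if "Suc i \<in> A" "i \<notin> A"
    using that assms sum.remove[of A "Suc i" "\<lambda>x. x"] by (simp add: jump_left_def left_nb_def)
  thus "Suc i \<in> A \<Longrightarrow> i \<notin> A \<Longrightarrow> \<Sum>(jump_left N (Suc i) A) < \<Sum>A" by simp
  show "\<Sum>(jump_left N (Suc i) A) \<le> \<Sum>A"
    using * by (cases "Suc i \<in> A \<and> i \<notin> A") (auto simp: jump_left_def left_nb_def)
qed

lemma no_gap_initial:
  fixes A :: "nat set"
  assumes "finite A" "\<And>i. Suc i \<in> A \<Longrightarrow> i \<in> A"
  shows "A = {..<card A}"
proof -
  have down: "j \<in> A" if "i \<in> A" "j \<le> i" for i j
    using that(2,1) by (induction rule: inc_induct) (use assms(2) in auto)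
  define n where "n = (LEAST n. n \<notin> A)"
  have "\<exists>n. n \<notin> A" using assms(1) ex_new_if_finite infinite_UNIV_nat by blast
  hence n: "n \<notin> A" unfolding n_def by (rule LeastI_ex)
  have "j \<in> A" if "j < n" for j using not_less_Least that unfolding n_def by blast
  moreover have "j < n" if "j \<in> A" for j using down[OF that, of n] n by force
  ultimately have "A = {..<n}" by auto
  thus ?thesis by simp
qed

text \<open>The sum of all positions is the potential. Ringing at \<open>Suc i\<close> where some
  set has a gap at \<open>i\<close> moves that set down and possibly others, but none up. Only site
  0, whose jumps wrap round the ring, could raise the sum, and it is never rung.\<close>

lemma multi_jump_sorts:
  assumes "As \<in> profiles N ts" "N > 0"
  shows "(As, map (\<lambda>t. {..<t}) ts) \<in> {(x, y). y \<in> set_pmf (multi_jump N x)}\<^sup>*"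
  using assms(1)
proof (induction "\<Sum>A\<leftarrow>As. \<Sum>A" arbitrary: As rule: less_induct)
  case less
  have sub: "A \<subseteq> {..<N}" if "A \<in> set As" for A
    using profiles_member[OF less.prems that] by (auto simp: subsets_of_card_def)
  show ?case
  proof (cases "\<forall>A\<in>set As. \<forall>i. Suc i \<in> A \<longrightarrow> i \<in> A")
    case True
    have "As = map (\<lambda>t. {..<t}) ts"
    proof (rule nth_equalityI)
      show "length As = length (map (\<lambda>t. {..<t}) ts)"
        using less.prems by (auto simp: profiles_def list_all2_lengthD)
      fix k assume k: "k < length As"
      hence "As ! k \<in> set As" by simp
      hence "As ! k = {..<card (As ! k)}"
        using True sub[of "As ! k"] by (intro no_gap_initial) (auto intro: finite_subset)
      moreover have "card (As ! k) = ts ! k" "k < length ts"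
        using less.prems k by (auto simp: profiles_def list_all2_conv_all_nth subsets_of_card_def)
      ultimately show "As ! k = map (\<lambda>t. {..<t}) ts ! k" by simp
    qed
    thus ?thesis by simp
  next
    case False
    then obtain A i where A: "A \<in> set As" "Suc i \<in> A" "i \<notin> A" by blast
    hence i: "Suc i < N" using sub by blast
    define Bs where "Bs = map (jump_left N (Suc i)) As"
    have "Bs \<in> set_pmf (multi_jump N As)"
      using i assms(2) unfolding multi_jump_def Bs_def by (subst set_map_pmf, subst set_pmf_of_set) auto
    moreover have "Bs \<in> profiles N ts"
      unfolding Bs_def by (rule profiles_jump_left[OF less.prems i])
    moreover have "(\<Sum>A\<leftarrow>Bs. \<Sum>A) < (\<Sum>A\<leftarrow>As. \<Sum>A)"
    proof -
      have fin: "finite A" if "A \<in> set As" for A using sub[OF that] finite_subset by blast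
      obtain xs ys where As: "As = xs @ A # ys" using A(1) by (meson split_list)
      have le: "(\<Sum>A\<leftarrow>zs. \<Sum>(jump_left N (Suc i) A)) \<le> (\<Sum>A\<leftarrow>zs. \<Sum>A)" if "set zs \<subseteq> set As" for zs
        using that fin by (intro sum_list_mono sum_jump_left(1)) auto
      have "set xs \<subseteq> set As" "set ys \<subseteq> set As" by (auto simp: As)
      from le[OF this(1)] le[OF this(2)] sum_jump_left(2)[OF fin[OF A(1)] A(2,3), of N]
      show ?thesis by (simp add: Bs_def As o_def)
    qed
    ultimately show ?thesis
      using less.hyps[of Bs] by (auto intro: converse_rtrancl_into_rtrancl)
  qed
qed

lemma multi_jump_stationary_unique:
  assumes "set_pmf p \<subseteq> profiles N ts" "bind_pmf p (multi_jump N) = p"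
    and "sorted_wrt (>) ts" "\<forall>t\<in>set ts. t \<le> N" "N > 0"
  shows "p = tandem_law N ts"
proof (rule stationary_unique[where X = "profiles N ts" and K = "multi_jump N"])
  fix As assume "As \<in> profiles N ts"
  thus "set_pmf (multi_jump N As) \<subseteq> profiles N ts"
    using assms(5) profiles_jump_left
    unfolding multi_jump_def by (subst set_map_pmf, subst set_pmf_of_set) auto
qed (use assms finite_profiles set_tandem_law tandem_law_stationary multi_jump_sorts in auto)

section \<open>Determinants of binomial coefficients\<close>

lemma det_mat_Leibniz:
  "Determinant.det (Matrix.mat m m (\<lambda>(i, j). f i j)) =
    (\<Sum>p | p permutes {0..<m}. signof p * (\<Prod>i<m. f i (p i)))"
  by (subst det_def'[of _ m]) (auto intro!: sum.cong prod.cong simp: atLeast0LessThan permutes_in_image)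

lemma det_mat_cong:
  assumes "\<And>i j. i < m \<Longrightarrow> j < m \<Longrightarrow> f i j = g i j"
  shows "Determinant.det (Matrix.mat m m (\<lambda>(i, j). f i j)) =
    Determinant.det (Matrix.mat m m (\<lambda>(i, j). g i j))"
  by (rule arg_cong[where f = Determinant.det]) (auto intro!: eq_matI simp: assms)

lemma det_rows_add:
  fixes f g :: "nat \<Rightarrow> nat \<Rightarrow> 'a :: comm_ring_1"
  shows "Determinant.det (Matrix.mat m m (\<lambda>(i, j). f i j + g i j)) =
    (\<Sum>X\<in>Pow {..<m}. Determinant.det (Matrix.mat m m (\<lambda>(i, j). if i \<in> X then f i j else g i j)))"
proof -
  have split: "(\<Prod>i<m. f i (p i) + g i (p i)) =
      (\<Sum>X\<in>Pow {..<m}. \<Prod>i<m. if i \<in> X then f i (p i) else g i (p i))" for p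
    unfolding prod_add[OF finite_lessThan]
  proof (rule sum.cong[OF refl])
    fix X :: "nat set" assume "X \<in> Pow {..<m}"
    hence "{..<m} \<inter> X = X" "{..<m} \<inter> - X = {..<m} - X" by auto
    thus "(\<Prod>x\<in>X. f x (p x)) * (\<Prod>x\<in>{..<m} - X. g x (p x)) =
        (\<Prod>i<m. if i \<in> X then f i (p i) else g i (p i))"
      by (simp add: prod.If_cases)
  qed
  show ?thesis unfolding det_mat_Leibniz split sum_distrib_left by (rule sum.swap)
qed

lemma det_rows_scale:
  fixes f :: "nat \<Rightarrow> nat \<Rightarrow> 'a :: comm_ring_1"
  shows "Determinant.det (Matrix.mat m m (\<lambda>(i, j). c i * f i j)) =
    (\<Prod>i<m. c i) * Determinant.det (Matrix.mat m m (\<lambda>(i, j). f i j))"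
  unfolding det_mat_Leibniz by (simp add: prod.distrib sum_distrib_left mult_ac)

lemma det_rows_diff:
  fixes f g :: "nat \<Rightarrow> nat \<Rightarrow> 'a :: comm_ring_1"
  shows "Determinant.det (Matrix.mat m m (\<lambda>(i, j). g i j - f i j)) =
    (\<Sum>X\<in>Pow {..<m}. (- 1) ^ card X *
      Determinant.det (Matrix.mat m m (\<lambda>(i, j). if i \<in> X then f i j else g i j)))"
proof -
  have "Determinant.det (Matrix.mat m m (\<lambda>(i, j). if i \<in> X then - f i j else g i j)) =
      (- 1) ^ card X * Determinant.det (Matrix.mat m m (\<lambda>(i, j). if i \<in> X then f i j else g i j))"
    if "X \<in> Pow {..<m}" for X
  proof -
    have "{..<m} \<inter> X = X" using that by auto
    hence sgn: "(\<Prod>i<m. if i \<in> X then - 1 else 1 :: 'a) = (- 1) ^ card X"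
      by (simp add: prod.If_cases)
    have "Determinant.det (Matrix.mat m m (\<lambda>(i, j). if i \<in> X then - f i j else g i j)) =
        Determinant.det (Matrix.mat m m
          (\<lambda>(i, j). (if i \<in> X then - 1 else 1) * (if i \<in> X then f i j else g i j)))"
      by (rule det_mat_cong) simp
    thus ?thesis by (simp only: det_rows_scale sgn)
  qed
  thus ?thesis using det_rows_add[of m "\<lambda>i j. - f i j" g] by simp
qed

lemma det_rows_equal:
  assumes "i < m" "k < m" "i \<noteq> k" "\<And>j. j < m \<Longrightarrow> f i j = f k j"
  shows "Determinant.det (Matrix.mat m m (\<lambda>(i, j). f i j)) = 0"
  by (rule det_identical_rows[of _ m i k]) (use assms in \<open>auto intro!: eq_vecI\<close>)

lemma det_zero_row:
  assumes "i < m" "\<And>j. j < m \<Longrightarrow> f i j = 0"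
  shows "Determinant.det (Matrix.mat m m (\<lambda>(i, j). f i j)) = 0"
proof -
  have "(\<Prod>k<m. f k (p k)) = 0" if "p permutes {0..<m}" for p
  proof (rule prod_zero)
    have "p i < m" using permutes_in_image[OF that, of i] assms(1) by simp
    thus "\<exists>k\<in>{..<m}. f k (p k) = 0" using assms by auto
  qed simp
  thus ?thesis by (simp add: det_mat_Leibniz)
qed

text \<open>This is right multiplication by an upper bidiagonal matrix. Pascal's rule, the
  difference identity and the scaling of columns (\<open>\<beta>\<close> zero) below are all of this
  form.\<close>

lemma det_columns_bidiagonal:
  fixes f g :: "nat \<Rightarrow> nat \<Rightarrow> 'a :: comm_ring_1"
  assumes "\<And>i j. i < m \<Longrightarrow> j < m \<Longrightarrow>
    f i j = \<alpha> j * g i j + (if j = 0 then 0 else \<beta> j * g i (j - 1))"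
  shows "Determinant.det (Matrix.mat m m (\<lambda>(i, j). f i j)) =
    (\<Prod>j<m. \<alpha> j) * Determinant.det (Matrix.mat m m (\<lambda>(i, j). g i j))"
proof -
  define B where "B = Matrix.mat m m (\<lambda>(k, j). if k = j then \<alpha> j else if Suc k = j then \<beta> j else 0)"
  have B: "B \<in> carrier_mat m m" by (simp add: B_def)
  have "Matrix.mat m m (\<lambda>(i, j). f i j) = Matrix.mat m m (\<lambda>(i, j). g i j) * B"
  proof (rule eq_matI)
    fix i j assume "i < dim_row (Matrix.mat m m (\<lambda>(i, j). g i j) * B)"
      "j < dim_col (Matrix.mat m m (\<lambda>(i, j). g i j) * B)"
    hence ij: "i < m" "j < m" by (auto simp: B_def)
    have "(Matrix.mat m m (\<lambda>(i, j). g i j) * B) $$ (i, j) =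
        (\<Sum>k<m. g i k * (if k = j then \<alpha> j else if Suc k = j then \<beta> j else 0))"
      using ij by (simp add: B_def times_mat_def scalar_prod_def atLeast0LessThan)
    also have "\<dots> = (\<Sum>k<m. (if k = j then \<alpha> j * g i j else 0) +
        (if k = j - 1 then (if j = 0 then 0 else \<beta> j * g i (j - 1)) else 0))"
      by (rule sum.cong) (auto simp: mult_ac)
    also have "\<dots> = f i j" using ij by (simp add: sum.distrib assms)
    finally show "Matrix.mat m m (\<lambda>(i, j). f i j) $$ (i, j) =
        (Matrix.mat m m (\<lambda>(i, j). g i j) * B) $$ (i, j)" using ij by simp
  qed (auto simp: B_def)
  moreover have "Determinant.det B = (\<Prod>j<m. \<alpha> j)"
  proof -
    have "upper_triangular B" by (auto simp: B_def upper_triangular_def)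
    hence "Determinant.det B = prod_list (diag_mat B)" using B by (rule det_upper_triangular)
    also have "\<dots> = (\<Prod>j<m. \<alpha> j)"
      by (simp add: diag_mat_def B_def prod.list_conv_set_nth atLeast0LessThan)
    finally show ?thesis .
  qed
  ultimately show ?thesis using B by (simp add: det_mult[of _ m] mult.commute)
qed

section \<open>Column operations on binomial coefficients\<close>

lemma binomial_shift_columns:
  fixes x :: "nat \<Rightarrow> nat"
  assumes "\<And>i. i < m \<Longrightarrow> x i \<ge> 1"
  shows "Determinant.det (Matrix.mat m m (\<lambda>(i, j). real (x i choose j))) =
    Determinant.det (Matrix.mat m m (\<lambda>(i, j). real ((x i - 1) choose j)))"
proof -
  have "real (x i choose j) = 1 * real ((x i - 1) choose j) +
      (if j = 0 then 0 else 1 * real ((x i - 1) choose (j - 1)))" if "i < m" for i j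
    using assms[OF that] by (cases "x i"; cases j) auto
  hence "Determinant.det (Matrix.mat m m (\<lambda>(i, j). real (x i choose j))) =
    (\<Prod>j<m. 1) * Determinant.det (Matrix.mat m m (\<lambda>(i, j). real ((x i - 1) choose j)))"
    by (intro det_columns_bidiagonal) auto
  thus ?thesis by simp
qed

text \<open>As a polynomial in \<open>y\<close>, (N - y) (y choose j) has degree j + 1, so its
  difference has degree j. That only the columns \<open>j\<close> and \<open>j - 1\<close> occur
  makes the column operation bidiagonal, and the diagonal entries \<open>j + 1\<close> multiply to
  m!.\<close>

lemma binomial_difference_identity:
  fixes y j N :: nat
  shows "(real N - real y) * real (y choose j) - (real N - real (Suc y)) * real (Suc y choose j) =
    (real j + 1) * real (y choose j) + (if j = 0 then 0 else (real j - real N) * real (y choose (j - 1)))"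
proof (cases j)
  case (Suc k)
  have "real y * real (y choose k) = real k * real (y choose k) + (real k + 1) * real (y choose Suc k)"
  proof (cases "k \<le> y")
    case True
    have "Suc k * (y choose Suc k) = (y - k) * (y choose k)"
      using binomial_absorption[of k y] binomial_absorb_comp[of y k] by (simp add: mult.commute)
    hence "real (Suc k) * real (y choose Suc k) = real (y - k) * real (y choose k)"
      by (metis of_nat_mult)
    thus ?thesis using True by (simp add: of_nat_diff algebra_simps)
  qed (simp add: binomial_eq_0)
  thus ?thesis by (simp add: Suc algebra_simps)
qed (simp add: algebra_simps)

text \<open>The sum over \<open>X\<close> is the multilinear expansion of a determinant whose rows
  are differences, with \<open>X\<close> the set of rows that take \<open>x i\<close> instead of
  \<open>x i - 1\<close>. Pascal's rule finally moves the arguments \<open>x i - 1\<close> back to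
  \<open>x i\<close>.\<close>

lemma det_binomial_difference:
  fixes x :: "nat \<Rightarrow> nat"
  assumes "\<And>i. i < m \<Longrightarrow> x i \<ge> 1"
  shows "(\<Sum>X\<in>Pow {..<m}. (- 1) ^ card X * Determinant.det (Matrix.mat m m (\<lambda>(i, j).
      (real N - real (x i - of_bool (i \<notin> X))) * real ((x i - of_bool (i \<notin> X)) choose j)))) =
    fact m * Determinant.det (Matrix.mat m m (\<lambda>(i, j). real (x i choose j)))"
proof -
  define f where "f = (\<lambda>i j. (real N - real (x i)) * real (x i choose j))"
  define g where "g = (\<lambda>i j. (real N - real (x i - 1)) * real ((x i - 1) choose j))"
  have "(\<Sum>X\<in>Pow {..<m}. (- 1) ^ card X * Determinant.det (Matrix.mat m m (\<lambda>(i, j).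
      (real N - real (x i - of_bool (i \<notin> X))) * real ((x i - of_bool (i \<notin> X)) choose j)))) =
      Determinant.det (Matrix.mat m m (\<lambda>(i, j). g i j - f i j))"
    unfolding det_rows_diff
    by (intro sum.cong refl arg_cong2[where f = "(*)"] det_mat_cong) (auto simp: f_def g_def)
  also have "\<dots> = (\<Prod>j<m. real j + 1) *
      Determinant.det (Matrix.mat m m (\<lambda>(i, j). real ((x i - 1) choose j)))"
  proof (rule det_columns_bidiagonal)
    fix i j assume "i < m" "j < m"
    hence "Suc (x i - 1) = x i" using assms[of i] by simp
    thus "g i j - f i j = (real j + 1) * real ((x i - 1) choose j) +
        (if j = 0 then 0 else (real j - real N) * real ((x i - 1) choose (j - 1)))"
      using binomial_difference_identity[of N "x i - 1" j] by (simp only: f_def g_def)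
  qed
  also have "(\<Prod>j<m. real j + 1) = fact m"
    by (simp add: fact_prod_Suc atLeast0LessThan add.commute)
  finally show ?thesis by (simp only: binomial_shift_columns[OF assms])
qed

text \<open>Both sides count the triples of a \<open>t\<close>-set, a \<open>j\<close>-subset of it
  and a point outside the \<open>t\<close>-set: the left side chooses the \<open>j\<close>-subset
  first, the right side the \<open>t\<close>-set.\<close>

lemma binomial_cross_identity:
  assumes "j < N" "j \<le> t" "t \<le> N"
  shows "(N - j) * (N choose j) * ((N - 1 - j) choose (t - j)) = (N choose t) * ((N - t) * (t choose j))"
proof -
  have "(N choose t) * (t choose j) = (N choose j) * ((N - j) choose (t - j))"
    using choose_mult[OF assms(2,3)] by (simp add: mult.commute)
  moreover have "(N - j - (t - j)) * ((N - j) choose (t - j)) = (N - j) * ((N - j - 1) choose (t - j))"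
    by (rule binomial_absorb_comp)
  moreover have "N - j - (t - j) = N - t" "N - j - 1 = N - 1 - j" using assms by auto
  ultimately show ?thesis by (metis mult.assoc mult.commute)
qed

text \<open>The cross identity turns row factors that depend on \<open>t i\<close> into column
  factors (N - j) (N choose j) = (j + 1) (N choose (j + 1)), whose product no longer depends on the
  thresholds.\<close>

lemma det_binomial_cross:
  fixes t :: "nat \<Rightarrow> nat"
  assumes "m \<le> N" "\<And>i. i < m \<Longrightarrow> t i \<le> N"
  shows "Determinant.det (Matrix.mat m m (\<lambda>(i, j).
      if t i < j then 0 else real ((N - 1 - j) choose (t i - j)))) * (fact m * (\<Prod>i=1..m. real (N choose i))) =
    (\<Prod>i<m. real (N choose t i)) *
      Determinant.det (Matrix.mat m m (\<lambda>(i, j). (real N - real (t i)) * real (t i choose j)))"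
proof -
  define b where "b = (\<lambda>i j. if t i < j then 0 else real ((N - 1 - j) choose (t i - j)))"
  define c where "c = (\<lambda>j. real (N - j) * real (N choose j))"
  have "real (N choose t i) * ((real N - real (t i)) * real (t i choose j)) = c j * b i j"
    if ij: "i < m" "j < m" for i j
  proof (cases "t i < j")
    case False
    have "real ((N - j) * (N choose j) * ((N - 1 - j) choose (t i - j))) =
        real ((N choose t i) * ((N - t i) * (t i choose j)))"
      using binomial_cross_identity[of j N "t i"] False ij assms by simp
    thus ?thesis using False assms(2)[OF ij(1)] by (simp add: b_def c_def of_nat_diff)
  qed (simp add: b_def)
  hence "(\<Prod>i<m. real (N choose t i)) *
      Determinant.det (Matrix.mat m m (\<lambda>(i, j). (real N - real (t i)) * real (t i choose j))) =
      Determinant.det (Matrix.mat m m (\<lambda>(i, j). c j * b i j))"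
    by (subst det_rows_scale[symmetric]) (intro det_mat_cong, simp)
  also have "\<dots> = (\<Prod>j<m. c j) * Determinant.det (Matrix.mat m m (\<lambda>(i, j). b i j))"
    by (rule det_columns_bidiagonal[where \<beta> = "\<lambda>_. 0"]) simp
  also have "(\<Prod>j<m. c j) = (\<Prod>j<m. real (Suc j) * real (N choose Suc j))"
  proof (rule prod.cong)
    fix j assume "j \<in> {..<m}"
    have "(N - j) * (N choose j) = Suc j * (N choose Suc j)"
      using binomial_absorption[of j N] binomial_absorb_comp[of N j] by simp
    thus "c j = real (Suc j) * real (N choose Suc j)" unfolding c_def by (metis of_nat_mult)
  qed simp
  also have "\<dots> = fact m * (\<Prod>i=1..m. real (N choose i))"
    by (simp add: prod.distrib fact_prod_Suc atLeast0LessThan prod.atLeast1_atMost_eq)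
  finally show ?thesis by (simp add: b_def mult.commute)
qed

section \<open>Decreasing words and idle services\<close>

text \<open>Nothing arrives before \<open>c\<close>, and from \<open>c\<close> on every site of the
  window offers a service, so each arrival is served at once.\<close>

lemma queue_zero_on_window:
  assumes "A \<subseteq> {..<N}" "S \<subseteq> {..<N}" "card A < card S" "w \<le> N"
    and S: "S \<inter> {..<w} = {c..<w}" and q: "queue N A S 0 = 0" and A: "A \<inter> {..<c} = {}"
    and "i < w"
  shows "queue N A S i = 0"
  using \<open>i < w\<close>
proof (induction i)
  case (Suc i)
  hence "i \<in> S \<longleftrightarrow> c \<le> i" using S by (metis Int_iff Suc_lessD atLeastLessThan_iff lessThan_iff)
  moreover have "i \<in> A \<Longrightarrow> c \<le> i" using A by fastforce
  ultimately show ?case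
    using Suc queue_Suc[OF assms(1-3), of i] assms(4) by (auto simp: netflow_def)
qed (simp add: q)

lemma departures_on_window:
  assumes "A \<subseteq> {..<N}" "S \<subseteq> {..<N}" "card A < card S" "w \<le> N"
    and "S \<inter> {..<w} = {c..<w}" "queue N A S 0 = 0" "A \<inter> {..<c} = {}"
  shows "departures N A S \<inter> {..<w} = A \<inter> {..<w}"
proof -
  have "i \<in> departures N A S \<longleftrightarrow> i \<in> A" if "i < w" for i
  proof -
    have "i \<in> S \<longleftrightarrow> c \<le> i"
      using assms(5) that by (metis Int_iff atLeastLessThan_iff lessThan_iff)
    moreover have "i \<in> A \<Longrightarrow> c \<le> i" using assms(7) by fastforce
    ultimately show ?thesis
      using queue_zero_on_window[OF assms that] by (auto simp: departures_def)
  qed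
  thus ?thesis by auto
qed

text \<open>An idle service certifies that nobody is waiting at \<open>c\<close>. No service
  precedes \<open>c\<close> in the window, so nobody can have been waiting at 0 or have arrived in
  between.\<close>

lemma queue_zero_of_idle_service:
  assumes "A \<subseteq> {..<N}" "S \<subseteq> {..<N}" "card A < card S" "w \<le> N"
    and S: "S \<inter> {..<w} = {c..<w}" and "c < w" and idle: "c \<notin> departures N A S"
  shows "queue N A S 0 = 0" "A \<inter> {..<c} = {}"
proof -
  note qe = queue_eq_queue[OF assms(1-3)]
  have "c \<in> S" using S \<open>c < w\<close> by (metis Int_iff atLeastLessThan_iff order_refl)
  hence "queue N A S c \<le> 0" using idle by (auto simp: departures_def)
  moreover have "c < N" using assms by simp
  ultimately have qc: "queue N A S c = 0" using queue_eq_nonneg[OF qe] by (metis antisym)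
  have step: "queue N A S i = 0 \<and> i \<notin> A" if "queue N A S (Suc i) = 0" "i < c" for i
  proof -
    have "i \<notin> S"
    proof
      assume "i \<in> S"
      hence "i \<in> S \<inter> {..<w}" using that(2) \<open>c < w\<close> by simp
      thus False unfolding S using that by simp
    qed
    moreover have "queue N A S i \<ge> 0" using queue_eq_nonneg[OF qe] that \<open>c < N\<close> by simp
    ultimately show ?thesis
      using queue_Suc[OF assms(1-3), of i] that \<open>c < N\<close>
      by (cases "i \<in> A") (auto simp: netflow_def)
  qed
  have zero: "queue N A S i = 0" if "i \<le> c" for i
    using that by (induction rule: inc_induct) (use qc step in auto)
  show "queue N A S 0 = 0" by (rule zero) simp
  show "A \<inter> {..<c} = {}" using step zero by fastforce
qed

text \<open>For \<open>w = length As\<close>, row \<open>p\<close> misses exactly the columns up to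
  \<open>p\<close>. The pattern is anchored at the last row, which is empty on the window, so that
  dropping the head leaves the condition on the other rows unchanged for the same \<open>w\<close>;
  the induction needs this.\<close>

definition window :: "nat \<Rightarrow> nat set list \<Rightarrow> bool" where
  "window w As \<longleftrightarrow> (\<forall>p<length As. As ! p \<inter> {..<w} = {w + p + 1 - length As..<w})"

lemma window_Cons:
  "window w (S # As) \<longleftrightarrow> S \<inter> {..<w} = {w - length As..<w} \<and> window w As"
  by (simp add: window_def All_less_Suc2)

lemma length_tandem [simp]: "length (tandem N Ss) = length Ss"
  by (induction Ss) auto

lemma tandem_subset:
  assumes "A \<in> set (tandem N (S # Ss))"
  shows "A \<subseteq> S"
  using assms departures_subset by auto

text \<open>The head row has a service in column \<open>c\<close> that the next row of the output
  does not use. This idle service forces the queue fed by \<open>B\<close> to be empty at 0.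
  Conversely, the other inputs of that queue are subsets of \<open>B\<close>, so by monotonicity
  their queues are empty too, and the window passes unchanged.\<close>

lemma window_tandem:
  assumes "Ss \<in> profiles N ts" "sorted_wrt (>) ts" "length ts \<le> w" "w \<le> N"
  shows "window w (tandem N Ss) \<longleftrightarrow>
    window w Ss \<and> (\<forall>p. Suc p < length Ss \<longrightarrow> queue N (Ss ! Suc p) (Ss ! p) 0 = 0)"
  using assms(1-3)
proof (induction ts arbitrary: Ss)
  case Nil
  thus ?case by (simp add: profiles_Nil window_def)
next
  case (Cons t ts)
  then obtain S Ss' where Ss: "Ss = S # Ss'" "S \<in> subsets_of_card N t" "Ss' \<in> profiles N ts"
    by (auto simp: profiles_Cons)
  define As where "As = tandem N Ss'"
  have IH: "window w As \<longleftrightarrow>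
      window w Ss' \<and> (\<forall>p. Suc p < length Ss' \<longrightarrow> queue N (Ss' ! Suc p) (Ss' ! p) 0 = 0)"
    unfolding As_def using Cons Ss by auto
  have len: "length As = length ts" "length Ss' = length ts"
    using Ss(3) by (auto simp: As_def profiles_def list_all2_lengthD)
  show ?case
  proof (cases Ss')
    case Nil
    thus ?thesis by (simp add: Ss window_Cons)
  next
    case (Cons B Bs)
    define c where "c = w - length ts"
    have cw: "c < w" "w - c = length ts" "length ts > 0"
      using Cons.prems(3) len(2) local.Cons by (auto simp: c_def)
    have S: "S \<subseteq> {..<N}" "card S = t" using Ss(2) by (auto simp: subsets_of_card_def)
    have "As \<in> profiles N ts" unfolding As_def using Ss(3) Cons.prems(2) by (intro tandem_profiles) auto
    hence A: "A \<subseteq> {..<N} \<and> card A < card S" if "A \<in> set As" for A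
      using profiles_member[OF _ that] Cons.prems(2) S by (auto simp: subsets_of_card_def)
    \<comment> \<open>\<open>tandem\<close> leaves its head unchanged, which is why the queue
      conditions compare adjacent rows of raw services rather than departures.\<close>
    have As0: "As ! 0 = B" "B \<in> set As" using local.Cons by (auto simp: As_def)
    have AB: "A \<subseteq> B" if "A \<in> set As" for A using that tandem_subset local.Cons by (auto simp: As_def)
    have dep: "departures N A S \<inter> {..<w} = A \<inter> {..<w}"
      if "S \<inter> {..<w} = {c..<w}" "queue N B S 0 = 0" "B \<inter> {..<c} = {}" "A \<in> set As" for A
    proof (rule departures_on_window[OF _ S(1) _ assms(4) that(1)])
      have "queue N A S 0 \<le> 0" using queue_mono[OF AB[OF that(4)], of N S 0] that(2) by simp
      moreover have "0 < N" using cw assms(4) by simp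
      ultimately show "queue N A S 0 = 0"
        using queue_eq_nonneg[OF queue_eq_queue[OF conjunct1[OF A[OF that(4)]] S(1)
          conjunct2[OF A[OF that(4)]]], of 0] by simp
      show "A \<inter> {..<c} = {}" using AB[OF that(4)] that(3) by blast
    qed (use A[OF that(4)] in auto)
    have key: "window w (map (\<lambda>A. departures N A S) As) \<longleftrightarrow> window w As \<and> queue N B S 0 = 0"
      if SW: "S \<inter> {..<w} = {c..<w}"
    proof -
      have same: "window w (map (\<lambda>A. departures N A S) As) \<longleftrightarrow> window w As"
        if "queue N B S 0 = 0" "B \<inter> {..<c} = {}"
        unfolding window_def using dep[OF SW that nth_mem] by simp
      have first: "w + 0 + 1 - length As = Suc c" "0 < length As"
        using len cw Cons.prems(3) by (auto simp: c_def)
      show ?thesis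
      proof
        assume W: "window w (map (\<lambda>A. departures N A S) As)"
        hence "departures N (As ! 0) S \<inter> {..<w} = {w + 0 + 1 - length As..<w}"
          unfolding window_def using first(2) by (metis length_map nth_map)
        hence "departures N B S \<inter> {..<w} = {Suc c..<w}" by (simp only: first As0)
        hence "c \<notin> departures N B S"
          using cw(1) by (metis Int_iff atLeastLessThan_iff lessThan_iff not_less_eq_eq order_refl)
        note Q = queue_zero_of_idle_service[OF conjunct1[OF A[OF As0(2)]] S(1)
            conjunct2[OF A[OF As0(2)]] assms(4) SW cw(1) this]
        show "window w As \<and> queue N B S 0 = 0" using same[OF Q] W Q(1) by blast
      next
        assume W: "window w As \<and> queue N B S 0 = 0"
        hence "As ! 0 \<inter> {..<w} = {w + 0 + 1 - length As..<w}"
          unfolding window_def using first(2) by blast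
        hence BW: "B \<inter> {..<w} = {Suc c..<w}" by (simp only: first As0)
        have "i \<notin> B" if "i < c" for i
        proof
          assume "i \<in> B"
          hence "i \<in> B \<inter> {..<w}" using that cw(1) by simp
          thus False unfolding BW using that by simp
        qed
        hence "B \<inter> {..<c} = {}" by blast
        thus "window w (map (\<lambda>A. departures N A S) As)" using W same by blast
      qed
    qed
    have queues: "(\<forall>p. Suc p < length Ss \<longrightarrow> queue N (Ss ! Suc p) (Ss ! p) 0 = 0) \<longleftrightarrow>
      queue N B S 0 = 0 \<and> (\<forall>p. Suc p < length Ss' \<longrightarrow> queue N (Ss' ! Suc p) (Ss' ! p) 0 = 0)"
    proof -
      have "(\<forall>p. Suc p < length Ss \<longrightarrow> queue N (Ss ! Suc p) (Ss ! p) 0 = 0) \<longleftrightarrow>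
          (\<forall>p<Suc (length Bs). queue N ((S # B # Bs) ! Suc p) ((S # B # Bs) ! p) 0 = 0)"
        by (simp add: Ss(1) local.Cons)
      also have "\<dots> \<longleftrightarrow> queue N B S 0 = 0 \<and>
          (\<forall>p<length Bs. queue N ((B # Bs) ! Suc p) ((B # Bs) ! p) 0 = 0)"
        by (simp add: All_less_Suc2)
      finally show ?thesis by (simp add: local.Cons)
    qed
    have out: "window w (tandem N Ss) \<longleftrightarrow>
        S \<inter> {..<w} = {c..<w} \<and> window w (map (\<lambda>A. departures N A S) As)"
      by (simp add: Ss(1) window_Cons As_def c_def len(2))
    have inp: "window w Ss \<longleftrightarrow> S \<inter> {..<w} = {c..<w} \<and> window w Ss'"
      by (simp add: Ss(1) window_Cons c_def len(2))
    show ?thesis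
    proof (cases "S \<inter> {..<w} = {c..<w}")
      case True
      thus ?thesis unfolding out inp queues key[OF True] IH by (simp only: conj_ac)
    next
      case False
      thus ?thesis unfolding out inp by simp
    qed
  qed
qed

section \<open>Counting dominated rows\<close>

text \<open>Rows are indexed from the smallest one. The shift by \<open>i\<close> counts the
  services of row \<open>i\<close> in the prescribed columns and turns weakly increasing sizes into
  strictly increasing \<open>\<tau>\<close>. Integers are used because deleting columns may push
  \<open>\<tau>\<close> below 0.\<close>

definition dominated_rows :: "nat \<Rightarrow> nat \<Rightarrow> nat \<Rightarrow> (nat \<Rightarrow> int) \<Rightarrow> (nat \<Rightarrow> nat set) set" where
  "dominated_rows m N c \<tau> = {T \<in> (\<Pi>\<^sub>E i\<in>{..<m}. Pow {c..<N}).
    (\<forall>i<m. int (card (T i)) + int i = \<tau> i) \<and>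
    (\<forall>i d. Suc i < m \<longrightarrow> c \<le> d \<longrightarrow> card (T i \<inter> {d..<N}) \<le> card (T (Suc i) \<inter> {d..<N}))}"

text \<open>Pascal's rule in \<open>M\<close> holds in each column. The dependence on
  \<open>j\<close> is chosen so that the matrix for \<open>M = 0\<close> and
  \<open>\<tau> i = int i\<close> is lower triangular with unit diagonal, and so that
  \<open>M = N - m\<close> gives the entries of \<open>binomial_cross_identity\<close>.\<close>

definition row_binomial :: "nat \<Rightarrow> nat \<Rightarrow> int \<Rightarrow> nat \<Rightarrow> real" where
  "row_binomial m M \<tau> j = (if \<tau> < int j then 0 else real ((M + m - 1 - j) choose nat (\<tau> - int j)))"

lemma finite_dominated_rows: "finite (dominated_rows m N c \<tau>)"
  by (rule finite_subset[of _ "\<Pi>\<^sub>E i\<in>{..<m}. Pow {c..<N}"]) (auto simp: dominated_rows_def intro: finite_PiE)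

lemma dominated_rows_subset:
  assumes "T \<in> dominated_rows m N c \<tau>" "i < m"
  shows "T i \<subseteq> {c..<N}"
  using assms by (auto simp: dominated_rows_def PiE_iff)

lemma dominated_rows_outside:
  assumes "T \<in> dominated_rows m N c \<tau>" "\<not> i < m"
  shows "T i = undefined"
  using assms by (auto simp: dominated_rows_def PiE_iff extensional_def)

lemma row_binomial_Suc:
  assumes "j < m"
  shows "row_binomial m (Suc M) \<tau> j = row_binomial m M (\<tau> - 1) j + row_binomial m M \<tau> j"
proof -
  have M: "Suc M + m - 1 - j = Suc (M + m - 1 - j)" using assms by simp
  consider "\<tau> < int j" | "\<tau> = int j" | n where "\<tau> - int j = int (Suc n)"
    by (metis diff_ge_0_iff_ge diff_gt_0_iff_gt gr0_implies_Suc linorder_less_linear zero_less_imp_eq_int)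
  thus ?thesis
  proof cases
    case 3
    hence "nat (\<tau> - int j) = Suc n" "nat (\<tau> - 1 - int j) = n" "\<not> \<tau> < int j" "\<not> \<tau> - 1 < int j" by auto
    thus ?thesis unfolding row_binomial_def M by simp
  qed (auto simp: row_binomial_def)
qed

text \<open>\<open>X\<close> records the rows that contain the leftmost column \<open>c\<close>.
  Domination from \<open>d = c\<close> on needs no separate count, since it only compares the sizes
  of whole rows.\<close>

lemma card_dominated_rows_Suc:
  assumes c: "c < N" and mono: "\<And>i. Suc i < m \<Longrightarrow> \<tau> i < \<tau> (Suc i)"
  shows "card (dominated_rows m N c \<tau>) =
    (\<Sum>X\<in>Pow {..<m}. card (dominated_rows m N (Suc c) (\<lambda>i. \<tau> i - of_bool (i \<in> X))))"
proof -
  define R where "R = (\<lambda>X. dominated_rows m N (Suc c) (\<lambda>i. \<tau> i - of_bool (i \<in> X)))"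
  define f where "f = (\<lambda>T. ({i\<in>{..<m}. c \<in> T i}, restrict (\<lambda>i. T i - {c}) {..<m}))"
  define g where "g = (\<lambda>(X, T). restrict (\<lambda>i. if i \<in> X then insert c (T i) else T i) {..<m})"
  have "bij_betw f (dominated_rows m N c \<tau>) (Sigma (Pow {..<m}) R)"
  proof (rule bij_betw_byWitness[where f' = g])
    show "\<forall>T\<in>dominated_rows m N c \<tau>. g (f T) = T"
    proof
      fix T assume T: "T \<in> dominated_rows m N c \<tau>"
      show "g (f T) = T"
      proof
        fix i
        show "g (f T) i = T i"
          using dominated_rows_outside[OF T, of i] by (cases "i < m") (auto simp: f_def g_def)
      qed
    qed
    have cT: "c \<notin> T i" if "T \<in> R X" "i < m" for T X i
      using dominated_rows_subset[OF that[unfolded R_def]] by auto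
    show "\<forall>P\<in>Sigma (Pow {..<m}) R. f (g P) = P"
    proof
      fix P assume "P \<in> Sigma (Pow {..<m}) R"
      then obtain X T where P: "P = (X, T)" and X: "X \<in> Pow {..<m}" and T: "T \<in> R X" by blast
      have "{i \<in> {..<m}. c \<in> g (X, T) i} = X" using X cT[OF T] by (auto simp: g_def)
      moreover have "restrict (\<lambda>i. g (X, T) i - {c}) {..<m} = T"
      proof
        fix i
        show "restrict (\<lambda>i. g (X, T) i - {c}) {..<m} i = T i"
        proof (cases "i < m")
          case True
          thus ?thesis using cT[OF T True] by (auto simp: g_def)
        next
          case False
          thus ?thesis using dominated_rows_outside[OF T[unfolded R_def] False] by simp
        qed
      qed
      ultimately show "f (g P) = P" by (simp add: f_def P)
    qed
    show "f ` dominated_rows m N c \<tau> \<subseteq> Sigma (Pow {..<m}) R"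
    proof (rule image_subsetI)
      fix T assume T: "T \<in> dominated_rows m N c \<tau>"
      define X where "X = {i\<in>{..<m}. c \<in> T i}"
      define T' where T': "T' = restrict (\<lambda>i. T i - {c}) {..<m}"
      have sub: "T i \<subseteq> {c..<N}" if "i < m" for i
        by (rule dominated_rows_subset[OF T that])
      have fin: "finite (T i)" if "i < m" for i using sub[OF that] finite_subset by blast
      have "T' \<in> (\<Pi>\<^sub>E i\<in>{..<m}. Pow {Suc c..<N})"
      proof (rule PiE_I)
        fix i assume "i \<in> {..<m}"
        hence "T i \<subseteq> {c..<N}" using sub by simp
        hence "x \<in> T i - {c} \<Longrightarrow> x \<in> {Suc c..<N}" for x by (cases "x = c") auto
        hence "T i - {c} \<subseteq> {Suc c..<N}" by blast
        thus "T' i \<in> Pow {Suc c..<N}" using \<open>i \<in> {..<m}\<close> by (simp add: T')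
      qed (simp add: T')
      moreover have "int (card (T' i)) + int i = \<tau> i - of_bool (i \<in> X)" if "i < m" for i
      proof -
        have "int (card (T i)) + int i = \<tau> i" using T that by (simp add: dominated_rows_def)
        moreover have "c \<in> T i \<Longrightarrow> card (T i) = Suc (card (T i - {c}))"
          using card.remove[OF fin[OF that]] by simp
        ultimately show ?thesis using that by (auto simp: T' X_def)
      qed
      moreover have "card (T' i \<inter> {d..<N}) \<le> card (T' (Suc i) \<inter> {d..<N})"
        if "Suc i < m" "Suc c \<le> d" for i d
      proof -
        have "T' k \<inter> {d..<N} = T k \<inter> {d..<N}" if "k < m" for k
          using \<open>Suc c \<le> d\<close> that by (auto simp: T')
        thus ?thesis using T that by (simp add: dominated_rows_def)
      qed
      ultimately have "T' \<in> R X" by (simp add: R_def dominated_rows_def)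
      moreover have "X \<in> Pow {..<m}" by (auto simp: X_def)
      ultimately show "f T \<in> Sigma (Pow {..<m}) R" by (simp add: f_def X_def T')
    qed
    show "g ` Sigma (Pow {..<m}) R \<subseteq> dominated_rows m N c \<tau>"
    proof (rule image_subsetI)
      fix P assume "P \<in> Sigma (Pow {..<m}) R"
      then obtain X T where P: "P = (X, T)" and X: "X \<in> Pow {..<m}" and T: "T \<in> R X" by blast
      define T' where "T' = g (X, T)"
      have T': "T' i = (if i \<in> X then insert c (T i) else T i)" if "i < m" for i
        using that by (simp add: T'_def g_def)
      have sub: "T i \<subseteq> {Suc c..<N}" if "i < m" for i
        by (rule dominated_rows_subset[OF T[unfolded R_def] that])
      have fin: "finite (T i)" if "i < m" for i using sub[OF that] finite_subset by blast
      have T'sub: "T' i \<subseteq> {c..<N}" if "i < m" for i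
        using sub[OF that] c by (auto simp: T'[OF that])
      have "T' \<in> (\<Pi>\<^sub>E i\<in>{..<m}. Pow {c..<N})"
        using T'sub by (intro PiE_I) (simp_all add: T'_def g_def)
      moreover have cardT': "int (card (T' i)) + int i = \<tau> i" if "i < m" for i
      proof -
        have "int (card (T i)) + int i = \<tau> i - of_bool (i \<in> X)"
          using T that by (simp add: R_def dominated_rows_def)
        thus ?thesis using cT[OF T that] fin[OF that]
          by (cases "i \<in> X") (simp_all add: T'[OF that])
      qed
      moreover have "card (T' i \<inter> {d..<N}) \<le> card (T' (Suc i) \<inter> {d..<N})"
        if i: "Suc i < m" and d: "c \<le> d" for i d
      proof (cases "d = c")
        case True
        \<comment> \<open>Here the suffix is the whole row; strict monotonicity of
          \<open>\<tau>\<close> says precisely that the sizes increase weakly.\<close>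
        have "T' i \<inter> {d..<N} = T' i" "T' (Suc i) \<inter> {d..<N} = T' (Suc i)"
          using T'sub[of i] T'sub[of "Suc i"] i True by auto
        thus ?thesis using cardT'[of i] cardT'[of "Suc i"] i mono[OF i] by simp
      next
        case False
        hence d': "Suc c \<le> d" using d by simp
        have "T' k \<inter> {d..<N} = T k \<inter> {d..<N}" if "k < m" for k
          using d' that by (auto simp: T')
        thus ?thesis using T i d' by (simp add: R_def dominated_rows_def)
      qed
      ultimately show "g P \<in> dominated_rows m N c \<tau>"
        by (simp add: dominated_rows_def T'_def P)
    qed
  qed
  hence "card (dominated_rows m N c \<tau>) = card (Sigma (Pow {..<m}) R)"
    by (rule bij_betw_same_card)
  also have "\<dots> = (\<Sum>X\<in>Pow {..<m}. card (R X))"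
    by (rule card_SigmaI) (auto simp: R_def finite_dominated_rows)
  finally show ?thesis by (simp add: R_def)
qed

lemma dominated_rows_weak:
  assumes "Suc i < m" "\<tau> i \<ge> \<tau> (Suc i)"
  shows "dominated_rows m N c \<tau> = {}"
proof -
  have False if T: "T \<in> dominated_rows m N c \<tau>" for T
  proof -
    have "T i \<subseteq> {c..<N}" "T (Suc i) \<subseteq> {c..<N}"
      using dominated_rows_subset[OF T] assms(1) by auto
    hence "T i \<inter> {c..<N} = T i" "T (Suc i) \<inter> {c..<N} = T (Suc i)" by auto
    moreover have "card (T i \<inter> {c..<N}) \<le> card (T (Suc i) \<inter> {c..<N})"
      using T assms(1) by (simp add: dominated_rows_def)
    moreover have "int (card (T i)) + int i = \<tau> i" "int (card (T (Suc i))) + int (Suc i) = \<tau> (Suc i)"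
      using T assms(1) unfolding dominated_rows_def by auto
    ultimately show False using assms(2) by simp
  qed
  thus ?thesis by blast
qed

lemma strict_int_lower:
  fixes \<tau> :: "nat \<Rightarrow> int"
  assumes "\<And>i. Suc i < m \<Longrightarrow> \<tau> i < \<tau> (Suc i)" "i \<le> k" "k < m"
  shows "\<tau> k - \<tau> i \<ge> int k - int i"
  using assms(2,3)
proof (induction k rule: dec_induct)
  case (step k)
  thus ?case using assms(1)[of k] by simp
qed simp

text \<open>Deleting the leftmost column is Pascal's rule in every row of the determinant; the terms that
  leave the chamber of strictly increasing \<open>\<tau>\<close> land on its wall, where two rows coincide.\<close>

lemma card_dominated_rows:
  assumes "c \<le> N" "\<And>i. Suc i < m \<Longrightarrow> \<tau> i < \<tau> (Suc i)"
  shows "real (card (dominated_rows m N c \<tau>)) =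
    Determinant.det (Matrix.mat m m (\<lambda>(i, j). row_binomial m (N - c) (\<tau> i) j))"
  using assms
proof (induction "N - c" arbitrary: c \<tau>)
  case 0
  hence c: "c = N" by simp
  show ?case
  proof (cases "\<forall>i<m. \<tau> i = int i")
    case True
    have "dominated_rows m N c \<tau> = {\<lambda>i\<in>{..<m}. {}}"
      unfolding dominated_rows_def using True c by (auto simp: PiE_iff extensional_def fun_eq_iff)
    moreover have "Determinant.det (Matrix.mat m m (\<lambda>(i, j). row_binomial m (N - c) (\<tau> i) j)) = 1"
    proof -
      let ?A = "Matrix.mat m m (\<lambda>(i, j). row_binomial m (N - c) (\<tau> i) j)"
      have "Determinant.det ?A = prod_list (diag_mat ?A)"
        by (rule det_lower_triangular[of m]) (use True in \<open>auto simp: row_binomial_def\<close>)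
      also have "diag_mat ?A = replicate m 1"
        by (rule nth_equalityI) (use True in \<open>auto simp: diag_mat_def row_binomial_def\<close>)
      finally show ?thesis by simp
    qed
    ultimately show ?thesis by simp
  next
    case False
    have "dominated_rows m N c \<tau> = {}"
    proof -
      have "\<tau> i = int i" if T: "T \<in> dominated_rows m N c \<tau>" "i < m" for T i
      proof -
        have "T i \<subseteq> {c..<N}" by (rule dominated_rows_subset[OF that])
        hence "T i = {}" using c by simp
        moreover have "int (card (T i)) + int i = \<tau> i" using that by (simp add: dominated_rows_def)
        ultimately show ?thesis by simp
      qed
      thus ?thesis using False by blast
    qed
    moreover have "Determinant.det (Matrix.mat m m (\<lambda>(i, j). row_binomial m (N - c) (\<tau> i) j)) = 0"
    proof -
      obtain i where i: "i < m" "\<tau> i \<noteq> int i" using False by blast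
      show ?thesis
      \<comment> \<open>Strict monotonicity carries a deviation to one end: too small a value forces
        \<open>\<tau> 0 < 0\<close>, too large a value forces
        \<open>\<tau> (m - 1) \<ge> int m\<close>, and the corresponding row of the matrix
        vanishes.\<close>
      proof (cases "\<tau> i < int i")
        case True
        hence "\<tau> 0 < 0" using strict_int_lower[of m \<tau> 0 i] "0.prems"(2) i by simp
        thus ?thesis by (intro det_zero_row[of 0]) (use i in \<open>auto simp: row_binomial_def\<close>)
      next
        case False
        hence *: "\<tau> (m - 1) \<ge> int m"
        proof -
          have "\<tau> (m - 1) - \<tau> i \<ge> int (m - 1) - int i"
            by (rule strict_int_lower[of m]) (use i "0.prems"(2) in auto)
          moreover have "int (m - 1) = int m - 1" using i by simp
          ultimately show ?thesis using i(2) False by linarith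
        qed
        have "m - 1 - j < nat (\<tau> (m - 1) - int j)" if "j < m" for j using * that by linarith
        thus ?thesis
          by (intro det_zero_row[of "m - 1"]) (use i c in \<open>auto simp: row_binomial_def binomial_eq_0\<close>)
      qed
    qed
    ultimately show ?thesis by simp
  qed
next
  case (Suc M)
  hence c: "c < N" and M: "N - Suc c = M" "N - c = Suc M" by auto
  have step: "real (card (dominated_rows m N (Suc c) \<sigma>)) =
      Determinant.det (Matrix.mat m m (\<lambda>(i, j). row_binomial m M (\<sigma> i) j))"
    if \<sigma>: "\<And>i. Suc i < m \<Longrightarrow> \<sigma> i \<le> \<sigma> (Suc i)" for \<sigma>
  proof (cases "\<exists>i. Suc i < m \<and> \<sigma> i = \<sigma> (Suc i)")
    case True
    then obtain i where i: "Suc i < m" "\<sigma> i = \<sigma> (Suc i)" by blast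
    have "Determinant.det (Matrix.mat m m (\<lambda>(i, j). row_binomial m M (\<sigma> i) j)) = 0"
      by (rule det_rows_equal[of i m "Suc i"]) (use i in auto)
    thus ?thesis using dominated_rows_weak[of i m \<sigma> N "Suc c"] i by simp
  next
    case False
    hence "\<sigma> i < \<sigma> (Suc i)" if "Suc i < m" for i using \<sigma>[OF that] that by fastforce
    thus ?thesis using Suc.hyps(1)[of "Suc c" \<sigma>] c M by simp
  qed
  have "real (card (dominated_rows m N c \<tau>)) =
      (\<Sum>X\<in>Pow {..<m}. real (card (dominated_rows m N (Suc c) (\<lambda>i. \<tau> i - of_bool (i \<in> X)))))"
    using card_dominated_rows_Suc[of c N m \<tau>, OF c Suc.prems(2)] by simp
  also have "\<dots> = (\<Sum>X\<in>Pow {..<m}. Determinant.det (Matrix.mat m m (\<lambda>(i, j).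
      if i \<in> X then row_binomial m M (\<tau> i - 1) j else row_binomial m M (\<tau> i) j)))"
  proof (rule sum.cong[OF refl])
    fix X :: "nat set"
    have "\<tau> i - of_bool (i \<in> X) \<le> \<tau> (Suc i) - of_bool (Suc i \<in> X)" if "Suc i < m" for i
      using Suc.prems(2)[OF that] by simp
    hence "real (card (dominated_rows m N (Suc c) (\<lambda>i. \<tau> i - of_bool (i \<in> X)))) =
      Determinant.det (Matrix.mat m m (\<lambda>(i, j). row_binomial m M (\<tau> i - of_bool (i \<in> X)) j))"
      by (rule step)
    also have "\<dots> = Determinant.det (Matrix.mat m m (\<lambda>(i, j).
      if i \<in> X then row_binomial m M (\<tau> i - 1) j else row_binomial m M (\<tau> i) j))"
      by (rule det_mat_cong) simp
    finally show "real (card (dominated_rows m N (Suc c) (\<lambda>i. \<tau> i - of_bool (i \<in> X)))) = \<dots>" .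
  qed
  also have "\<dots> = Determinant.det (Matrix.mat m m (\<lambda>(i, j).
      row_binomial m M (\<tau> i - 1) j + row_binomial m M (\<tau> i) j))"
    by (rule det_rows_add[symmetric])
  also have "\<dots> = Determinant.det (Matrix.mat m m (\<lambda>(i, j). row_binomial m (N - c) (\<tau> i) j))"
    unfolding M by (rule det_mat_cong) (simp add: row_binomial_Suc)
  finally show ?case .
qed

section \<open>Decreasing prefixes of the TASEP\<close>

text \<open>In the prescribed columns domination holds by inclusion, so a suffix that starts inside
  them inherits it from the suffix that starts at \<open>m\<close>.\<close>

lemma suffix_dominance_outside_window:
  fixes A S :: "nat set"
  assumes "A \<subseteq> {..<N}" "S \<subseteq> {..<N}" "m \<le> N" "A \<inter> {..<m} \<subseteq> S \<inter> {..<m}"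
  shows "(\<forall>c\<le>N. card (A \<inter> {c..<N}) \<le> card (S \<inter> {c..<N})) \<longleftrightarrow>
    (\<forall>d\<ge>m. card (A \<inter> {m..<N} \<inter> {d..<N}) \<le> card (S \<inter> {m..<N} \<inter> {d..<N}))"
    (is "?L \<longleftrightarrow> ?R")
proof
  assume L: ?L
  show ?R
  proof (intro allI impI)
    fix d assume "m \<le> d"
    hence "B \<inter> {m..<N} \<inter> {d..<N} = B \<inter> {d..<N}" for B :: "nat set" by auto
    thus "card (A \<inter> {m..<N} \<inter> {d..<N}) \<le> card (S \<inter> {m..<N} \<inter> {d..<N})"
      using L by (cases "d \<le> N") auto
  qed
next
  assume R: ?R
  show ?L
  proof (intro allI impI)
    fix c assume c: "c \<le> N"
    show "card (A \<inter> {c..<N}) \<le> card (S \<inter> {c..<N})"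
    proof (cases "m \<le> c")
      case True
      hence "B \<inter> {m..<N} \<inter> {c..<N} = B \<inter> {c..<N}" for B :: "nat set" by auto
      thus ?thesis using R True by metis
    next
      case False
      have split: "card (B \<inter> {c..<N}) = card (B \<inter> {m..<N}) + card (B \<inter> {c..<m})" for B :: "nat set"
      proof -
        have "B \<inter> {c..<N} = (B \<inter> {m..<N}) \<union> (B \<inter> {c..<m})" using False assms(3) by auto
        thus ?thesis by (simp only:) (rule card_Un_disjoint, auto)
      qed
      have "A \<inter> {c..<m} \<subseteq> S \<inter> {c..<m}" using assms(4) by auto
      hence "card (A \<inter> {c..<m}) \<le> card (S \<inter> {c..<m})" by (intro card_mono) auto
      moreover have "card (A \<inter> {m..<N}) \<le> card (S \<inter> {m..<N})"
        using R[rule_format, of m] by (simp add: Int_assoc)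
      ultimately show ?thesis by (simp add: split)
    qed
  qed
qed

text \<open>Thresholds increase with their index, whereas rows are listed with the last and largest
  queue first; hence the reversal.\<close>

definition row_sizes :: "nat \<Rightarrow> (nat \<Rightarrow> nat) \<Rightarrow> nat list" where
  "row_sizes m t = map (\<lambda>p. t (m - 1 - p)) [0..<m]"

lemma length_row_sizes [simp]: "length (row_sizes m t) = m"
  by (simp add: row_sizes_def)

lemma nth_row_sizes [simp]: "p < m \<Longrightarrow> row_sizes m t ! p = t (m - 1 - p)"
  by (simp add: row_sizes_def)

lemma strict_mono_below:
  fixes t :: "nat \<Rightarrow> nat"
  assumes "\<And>i. Suc i < m \<Longrightarrow> t i < t (Suc i)" "i < k" "k < m"
  shows "t i < t k"
  using assms(2,3)
proof (induction k)
  case (Suc k)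
  thus ?case using assms(1)[of k] by (cases "i = k") auto
qed simp

lemma sorted_row_sizes:
  assumes "\<And>i. Suc i < m \<Longrightarrow> t i < t (Suc i)"
  shows "sorted_wrt (>) (row_sizes m t)"
  using strict_mono_below[of m t, OF assms]
  by (simp add: sorted_wrt_iff_nth_less)

lemma prod_row_sizes: "(\<Prod>s\<leftarrow>row_sizes m t. f s) = (\<Prod>i<m. f (t i))"
proof -
  have "(\<Prod>s\<leftarrow>row_sizes m t. f s) = (\<Prod>p<m. f (t (m - 1 - p)))"
    by (simp add: row_sizes_def prod.list_conv_set_nth atLeast0LessThan)
  also have "\<dots> = (\<Prod>i<m. f (t i))"
    by (rule prod.reindex_bij_witness[of _ "\<lambda>i. m - 1 - i" "\<lambda>i. m - 1 - i"]) auto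
  finally show ?thesis .
qed

text \<open>The bijection deletes the prescribed columns and reverses the order of the rows. Row
  \<open>i\<close> in the new order has \<open>i\<close> services in these columns, so
  \<open>t i - i\<close> of them remain.\<close>

lemma card_window_profiles:
  fixes t :: "nat \<Rightarrow> nat"
  assumes m: "m \<le> N" and mono: "\<And>i. Suc i < m \<Longrightarrow> t i < t (Suc i)"
  shows "card {Ss \<in> profiles N (row_sizes m t). window m (tandem N Ss)} =
    card (dominated_rows m N m (\<lambda>i. int (t i)))"
proof -
  let ?ts = "row_sizes m t"
  define W where "W = {Ss \<in> profiles N ?ts. window m (tandem N Ss)}"
  define f where "f = (\<lambda>Ss. restrict (\<lambda>i. Ss ! (m - 1 - i) \<inter> {m..<N}) {..<m})"
  define g where "g = (\<lambda>T. map (\<lambda>p. T (m - 1 - p) \<union> {p + 1..<m}) [0..<m])"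
  have W: "Ss \<in> W \<longleftrightarrow> length Ss = m \<and>
      (\<forall>p<m. Ss ! p \<subseteq> {..<N} \<and> card (Ss ! p) = t (m - 1 - p) \<and> Ss ! p \<inter> {..<m} = {p + 1..<m}) \<and>
      (\<forall>p. Suc p < m \<longrightarrow> (\<forall>d\<ge>m. card (Ss ! Suc p \<inter> {m..<N} \<inter> {d..<N}) \<le>
        card (Ss ! p \<inter> {m..<N} \<inter> {d..<N})))" (is "_ \<longleftrightarrow> ?P Ss \<and> ?Q Ss \<and> ?R Ss") for Ss
  proof -
    have prof: "Ss \<in> profiles N ?ts \<longleftrightarrow>
        ?P Ss \<and> (\<forall>p<m. Ss ! p \<subseteq> {..<N} \<and> card (Ss ! p) = t (m - 1 - p))"
      by (auto simp: profiles_def list_all2_conv_all_nth subsets_of_card_def)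
    have win: "?P Ss \<Longrightarrow> window m Ss \<longleftrightarrow> (\<forall>p<m. Ss ! p \<inter> {..<m} = {p + 1..<m})"
      by (simp add: window_def)
    have queues: "queue N (Ss ! Suc p) (Ss ! p) 0 = 0 \<longleftrightarrow>
        (\<forall>d\<ge>m. card (Ss ! Suc p \<inter> {m..<N} \<inter> {d..<N}) \<le> card (Ss ! p \<inter> {m..<N} \<inter> {d..<N}))"
      if Q: "?Q Ss" and p: "Suc p < m" for p
    proof -
      have Sp: "Ss ! Suc p \<subseteq> {..<N}" "Ss ! p \<subseteq> {..<N}" using Q p by auto
      have "m - 1 - p = Suc (m - 1 - Suc p)" using p by simp
      moreover have "Suc (m - 1 - Suc p) < m" using p by simp
      ultimately have "t (m - 1 - Suc p) < t (m - 1 - p)" using mono by metis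
      hence lt: "card (Ss ! Suc p) < card (Ss ! p)" using Q p by simp
      have "Ss ! Suc p \<inter> {..<m} = {Suc p + 1..<m}" "Ss ! p \<inter> {..<m} = {p + 1..<m}"
        using Q p by auto
      hence "Ss ! Suc p \<inter> {..<m} \<subseteq> Ss ! p \<inter> {..<m}" by (simp only:) auto
      thus ?thesis
        unfolding queue_0_eq_0_iff[OF Sp lt] by (rule suffix_dominance_outside_window[OF Sp m])
    qed
    have "Ss \<in> W \<longleftrightarrow> Ss \<in> profiles N ?ts \<and> window m Ss \<and>
        (\<forall>p. Suc p < length Ss \<longrightarrow> queue N (Ss ! Suc p) (Ss ! p) 0 = 0)"
      using window_tandem[of Ss N ?ts m] sorted_row_sizes[of m t, OF mono] m by (auto simp: W_def)
    also have "\<dots> \<longleftrightarrow> ?P Ss \<and> ?Q Ss \<and> (\<forall>p. Suc p < m \<longrightarrow> queue N (Ss ! Suc p) (Ss ! p) 0 = 0)"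
      unfolding prof using win by auto
    also have "\<dots> \<longleftrightarrow> ?P Ss \<and> ?Q Ss \<and> ?R Ss"
    proof -
      have "(\<forall>p. Suc p < m \<longrightarrow> queue N (Ss ! Suc p) (Ss ! p) 0 = 0) \<longleftrightarrow> ?R Ss" if "?Q Ss"
        by (intro iff_allI imp_cong refl queues[OF that])
      thus ?thesis by (intro conj_cong refl)
    qed
    finally show ?thesis .
  qed
  have part: "card (A \<inter> {m..<N}) + card (A \<inter> {..<m}) = card A" if "A \<subseteq> {..<N}" for A
  proof -
    have "A = (A \<inter> {m..<N}) \<union> (A \<inter> {..<m})" using that by auto
    moreover have "card ((A \<inter> {m..<N}) \<union> (A \<inter> {..<m})) = card (A \<inter> {m..<N}) + card (A \<inter> {..<m})"
      by (rule card_Un_disjoint) auto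
    ultimately show ?thesis by simp
  qed
  have "bij_betw f W (dominated_rows m N m (\<lambda>i. int (t i)))"
  proof (rule bij_betw_byWitness[where f' = g])
    show "\<forall>Ss\<in>W. g (f Ss) = Ss"
    proof
      fix Ss assume "Ss \<in> W"
      hence Ss: "length Ss = m" "\<And>p. p < m \<Longrightarrow> Ss ! p \<subseteq> {..<N}"
        "\<And>p. p < m \<Longrightarrow> Ss ! p \<inter> {..<m} = {p + 1..<m}" unfolding W by blast+
      show "g (f Ss) = Ss"
      proof (rule nth_equalityI)
        show "length (g (f Ss)) = length Ss" by (simp add: g_def Ss)
        fix p assume "p < length (g (f Ss))"
        hence p: "p < m" by (simp add: g_def)
        have "g (f Ss) ! p = (Ss ! p \<inter> {m..<N}) \<union> (Ss ! p \<inter> {..<m})"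
          using p Ss(3)[OF p] by (simp add: g_def f_def)
        also have "\<dots> = Ss ! p" using Ss(2)[OF p] by auto
        finally show "g (f Ss) ! p = Ss ! p" .
      qed
    qed
    have gT: "g T ! (m - 1 - i) \<inter> {m..<N} = T i" "g T ! (m - 1 - i) \<inter> {..<m} = {m - i..<m}"
      "g T ! (m - 1 - i) \<subseteq> {..<N}"
      if T: "T \<in> dominated_rows m N m (\<lambda>i. int (t i))" and i: "i < m" for T i
    proof -
      have "g T ! (m - 1 - i) = T i \<union> {m - i..<m}" using i by (simp add: g_def Suc_diff_Suc)
      moreover have "T i \<subseteq> {m..<N}" by (rule dominated_rows_subset[OF T i])
      ultimately show "g T ! (m - 1 - i) \<inter> {m..<N} = T i" "g T ! (m - 1 - i) \<inter> {..<m} = {m - i..<m}"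
        "g T ! (m - 1 - i) \<subseteq> {..<N}" using m by auto
    qed
    show "\<forall>T\<in>dominated_rows m N m (\<lambda>i. int (t i)). f (g T) = T"
    proof
      fix T assume T: "T \<in> dominated_rows m N m (\<lambda>i. int (t i))"
      show "f (g T) = T"
      proof
        fix i
        show "f (g T) i = T i"
          using gT(1)[OF T] dominated_rows_outside[OF T] by (cases "i < m") (simp_all add: f_def)
      qed
    qed
    show "f ` W \<subseteq> dominated_rows m N m (\<lambda>i. int (t i))"
    proof (rule image_subsetI)
      fix Ss assume "Ss \<in> W"
      hence Q: "?Q Ss" and R: "?R Ss" unfolding W by blast+
      have "f Ss \<in> (\<Pi>\<^sub>E i\<in>{..<m}. Pow {m..<N})" by (auto simp: f_def)
      moreover have "int (card (f Ss i)) + int i = int (t i)" if "i < m" for i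
      proof -
        have "m - 1 - i < m" "m - 1 - (m - 1 - i) = i" "m - 1 - i + 1 = m - i" using that by auto
        hence "Ss ! (m - 1 - i) \<subseteq> {..<N}" "card (Ss ! (m - 1 - i)) = t i"
          "Ss ! (m - 1 - i) \<inter> {..<m} = {m - i..<m}" using Q by metis+
        thus ?thesis using part[of "Ss ! (m - 1 - i)"] that by (simp add: f_def)
      qed
      moreover have "card (f Ss i \<inter> {d..<N}) \<le> card (f Ss (Suc i) \<inter> {d..<N})"
        if "Suc i < m" "m \<le> d" for i d
      proof -
        have "Suc (m - 1 - Suc i) < m" "Suc (m - 1 - Suc i) = m - 1 - i" using that by auto
        hence "card (Ss ! (m - 1 - i) \<inter> {m..<N} \<inter> {d..<N}) \<le>
            card (Ss ! (m - 1 - Suc i) \<inter> {m..<N} \<inter> {d..<N})" using R that(2) by metis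
        thus ?thesis using that by (simp add: f_def)
      qed
      ultimately show "f Ss \<in> dominated_rows m N m (\<lambda>i. int (t i))"
        by (simp add: dominated_rows_def)
    qed
    show "g ` dominated_rows m N m (\<lambda>i. int (t i)) \<subseteq> W"
    proof (rule image_subsetI)
      fix T assume T: "T \<in> dominated_rows m N m (\<lambda>i. int (t i))"
      have "g T ! p \<subseteq> {..<N} \<and> card (g T ! p) = t (m - 1 - p) \<and> g T ! p \<inter> {..<m} = {p + 1..<m}"
        if p: "p < m" for p
      proof -
        define i where "i = m - 1 - p"
        have i: "i < m" "m - 1 - i = p" "m - i = p + 1" using p by (auto simp: i_def)
        have "int (card (T i)) + int i = int (t i)" using T i(1) by (simp add: dominated_rows_def)
        note G = gT[OF T i(1), unfolded i(2,3)]
        have "card (T i) + card {p + 1..<m} = card (g T ! p)"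
          using part[OF G(3)] unfolding G(1,2) .
        moreover have "card {p + 1..<m} = i" using p by (simp add: i_def)
        ultimately have "card (g T ! p) = t i" using \<open>int (card (T i)) + int i = int (t i)\<close> by simp
        thus ?thesis using G(2,3) by (simp only: i_def)
      qed
      moreover have "card (g T ! Suc p \<inter> {m..<N} \<inter> {d..<N}) \<le> card (g T ! p \<inter> {m..<N} \<inter> {d..<N})"
        if p: "Suc p < m" and d: "m \<le> d" for p d
      proof -
        define i where "i = m - 1 - Suc p"
        have i: "Suc i < m" "i < m" "m - 1 - i = Suc p" "m - 1 - Suc i = p" using p by (auto simp: i_def)
        have "card (T i \<inter> {d..<N}) \<le> card (T (Suc i) \<inter> {d..<N})"
          using T i(1) d by (simp add: dominated_rows_def)
        thus ?thesis using gT(1)[OF T i(2)] gT(1)[OF T i(1)] by (simp only: i(3,4))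
      qed
      moreover have "length (g T) = m" by (simp add: g_def)
      ultimately show "g T \<in> W" unfolding W by blast
    qed
  qed
  thus ?thesis unfolding W_def by (rule bij_betw_same_card)
qed

lemma prob_window:
  fixes t :: "nat \<Rightarrow> nat"
  assumes m: "m \<le> N" and mono: "\<And>i. Suc i < m \<Longrightarrow> t i < t (Suc i)"
    and tN: "\<And>i. i < m \<Longrightarrow> t i \<le> N"
  shows "measure_pmf.prob (tandem_law N (row_sizes m t)) {As. window m As} =
    Determinant.det (Matrix.mat m m (\<lambda>(i, j). (real N - real (t i)) * real (t i choose j))) /
    (fact m * (\<Prod>i=1..m. real (N choose i)))"
proof -
  let ?P = "profiles N (row_sizes m t)"
  have le: "\<forall>s\<in>set (row_sizes m t). s \<le> N" using tN by (auto simp: row_sizes_def)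
  have "measure_pmf.prob (tandem_law N (row_sizes m t)) {As. window m As} =
      real (card {Ss \<in> ?P. window m (tandem N Ss)}) / real (card ?P)"
    unfolding tandem_law_def measure_map_pmf
    by (subst measure_pmf_of_set[OF profiles_nonempty[OF le] finite_profiles])
      (simp add: Int_def vimage_def)
  also have "real (card ?P) = (\<Prod>i<m. real (N choose t i))"
    by (simp add: card_profiles prod_row_sizes[where f = "\<lambda>s. N choose s"])
  also have "real (card {Ss \<in> ?P. window m (tandem N Ss)}) =
      Determinant.det (Matrix.mat m m (\<lambda>(i, j). row_binomial m (N - m) (int (t i)) j))"
    using card_window_profiles[of m N t, OF m mono]
      card_dominated_rows[of m N m "\<lambda>i. int (t i)"] m mono by simp
  also have "\<dots> = Determinant.det (Matrix.mat m m (\<lambda>(i, j).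
      if t i < j then 0 else real ((N - 1 - j) choose (t i - j))))" (is "_ = ?D")
    by (rule det_mat_cong) (use m in \<open>auto simp: row_binomial_def nat_diff_distrib\<close>)
  finally have *: "measure_pmf.prob (tandem_law N (row_sizes m t)) {As. window m As} =
      ?D / (\<Prod>i<m. real (N choose t i))" .
  have "(\<Prod>i<m. real (N choose t i)) > 0" using tN by (intro prod_pos) auto
  hence n1: "(\<Prod>i<m. real (N choose t i)) \<noteq> 0" by linarith
  have "fact m * (\<Prod>i=1..m. real (N choose i)) > 0"
    using m by (intro mult_pos_pos prod_pos) auto
  hence n2: "fact m * (\<Prod>i=1..m. real (N choose i)) \<noteq> 0" by linarith
  show ?thesis unfolding * frac_eq_eq[OF n1 n2]
    by (rule trans[OF det_binomial_cross[of m N t, OF m tN] mult.commute])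
qed

section \<open>From words to level sets and back to letters\<close>

definition level_sets :: "nat list \<Rightarrow> nat list \<Rightarrow> nat set list" where
  "level_sets ts u = map (\<lambda>t. {k. k < length u \<and> u ! k \<le> t}) ts"

lemma length_tasep_jump [simp]: "length (tasep_jump u i) = length u"
  by (simp add: tasep_jump_def Let_def)

text \<open>A threshold sees an exchange only if it separates the two letters. In all other cases
  site \<open>i\<close> is outside the level set or its left neighbour is inside, and
  \<open>jump_left\<close> is idle as well.\<close>

lemma level_sets_tasep_jump:
  assumes i: "i < length u"
  shows "level_sets ts (tasep_jump u i) = map (jump_left (length u) i) (level_sets ts u)"
proof -
  define l where "l = left_nb (length u) i"
  have l: "l < length u" using i by (simp add: l_def left_nb_less)
  have "{k. k < length u \<and> tasep_jump u i ! k \<le> t} =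
      jump_left (length u) i {k. k < length u \<and> u ! k \<le> t}" for t
  proof (cases "u ! i < u ! l")
    case True
    hence "l \<noteq> i" by auto
    thus ?thesis using True i l
      by (auto simp: tasep_jump_def jump_left_def Let_def l_def[symmetric] nth_list_update split: if_splits)
  next
    case False
    thus ?thesis using i l by (auto simp: tasep_jump_def jump_left_def Let_def l_def[symmetric])
  qed
  thus ?thesis by (simp add: level_sets_def)
qed

lemma level_sets_profiles:
  assumes u: "u \<in> tasep_states N" and ts: "\<forall>t\<in>set ts. t \<le> N"
  shows "level_sets ts u \<in> profiles N ts"
proof -
  have u': "distinct u" "set u = {1..N}" using u by (auto simp: tasep_states_def permutations_of_set_def)
  hence len: "length u = N" using distinct_card by fastforce
  have "{k. k < length u \<and> u ! k \<le> t} \<in> subsets_of_card N t" if "t \<le> N" for t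
  proof -
    let ?A = "{k. k < length u \<and> u ! k \<le> t}"
    have "inj_on ((!) u) ?A" using u'(1) by (auto simp: inj_on_def nth_eq_iff_index_eq)
    moreover have "(!) u ` ?A = {1..t}"
    proof (rule Set.set_eqI)
      fix y
      have "y \<in> (!) u ` ?A \<longleftrightarrow> y \<in> set u \<and> y \<le> t" by (auto simp: in_set_conv_nth)
      thus "y \<in> (!) u ` ?A \<longleftrightarrow> y \<in> {1..t}" using that by (auto simp: u'(2))
    qed
    ultimately have "card ?A = t" using card_image by fastforce
    thus ?thesis using len by (auto simp: subsets_of_card_def)
  qed
  thus ?thesis using ts by (auto simp: profiles_def level_sets_def list_all2_conv_all_nth)
qed

text \<open>The level sets intertwine the two kernels, so the image of a stationary law is
  stationary for the coupled chain, whose stationary law on these sizes is unique.\<close>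

lemma level_sets_law:
  assumes st: "tasep_stationary N \<pi>" and N: "N > 0"
    and ts: "sorted_wrt (>) ts" "\<forall>t\<in>set ts. t \<le> N"
  shows "map_pmf (level_sets ts) \<pi> = tandem_law N ts"
proof (rule multi_jump_stationary_unique[OF _ _ ts N])
  have sub: "set_pmf \<pi> \<subseteq> tasep_states N" and inv: "bind_pmf \<pi> tasep_kernel = \<pi>"
    using st by (auto simp: tasep_stationary_def)
  show "set_pmf (map_pmf (level_sets ts) \<pi>) \<subseteq> profiles N ts"
    using sub level_sets_profiles[OF _ ts(2)] by auto
  have len: "length u = N" if "u \<in> set_pmf \<pi>" for u
    using sub that by (auto simp: tasep_states_def permutations_of_set_def dest!: distinct_card)
  have "multi_jump N (level_sets ts u) = map_pmf (level_sets ts) (tasep_kernel u)"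
    if "u \<in> set_pmf \<pi>" for u
  proof -
    have "set_pmf (pmf_of_set {..<N}) = {..<N}" using N by (intro set_pmf_of_set) auto
    thus ?thesis unfolding multi_jump_def tasep_kernel_def pmf.map_comp len[OF that]
      by (intro map_pmf_cong refl) (simp add: level_sets_tasep_jump len[OF that])
  qed
  hence "bind_pmf \<pi> (\<lambda>u. multi_jump N (level_sets ts u)) =
      bind_pmf \<pi> (\<lambda>u. map_pmf (level_sets ts) (tasep_kernel u))"
    by (intro bind_pmf_cong refl)
  also have "\<dots> = map_pmf (level_sets ts) (bind_pmf \<pi> tasep_kernel)"
    by (simp add: map_bind_pmf)
  finally show "bind_pmf (map_pmf (level_sets ts) \<pi>) (multi_jump N) = map_pmf (level_sets ts) \<pi>"
    by (simp add: inv bind_map_pmf)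
qed

text \<open>Writing y_i for the letter at position m - 1 - i, this is the chain t_0 < y_0 <= t_1 <
  y_1 <= ... <= t_(m-1) < y_(m-1). The largest letter has no upper bound, so \<open>m\<close>
  thresholds suffice.\<close>

definition interlaced :: "nat \<Rightarrow> (nat \<Rightarrow> nat) \<Rightarrow> nat list \<Rightarrow> bool" where
  "interlaced m t u \<longleftrightarrow> (\<forall>i<m. t i < u ! (m - 1 - i) \<and> (i > 0 \<longrightarrow> u ! (m - 1 - (i - 1)) \<le> t i))"

lemma Int_lessThan_eq_iff:
  "A \<inter> {..<m} = {p + 1..<m} \<longleftrightarrow> (\<forall>k<m. k \<in> A \<longleftrightarrow> p < k)" for m p :: nat
proof
  assume L: "A \<inter> {..<m} = {p + 1..<m}"
  show "\<forall>k<m. k \<in> A \<longleftrightarrow> p < k"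
  proof (intro allI impI)
    fix k assume k: "k < m"
    hence "k \<in> A \<longleftrightarrow> k \<in> A \<inter> {..<m}" by simp
    also have "\<dots> \<longleftrightarrow> p < k" unfolding L using k by auto
    finally show "k \<in> A \<longleftrightarrow> p < k" .
  qed
next
  assume R: "\<forall>k<m. k \<in> A \<longleftrightarrow> p < k"
  show "A \<inter> {..<m} = {p + 1..<m}"
  proof (rule Set.set_eqI)
    fix k
    show "k \<in> A \<inter> {..<m} \<longleftrightarrow> k \<in> {p + 1..<m}" using R by (cases "k < m") auto
  qed
qed

text \<open>Both sides locate every letter among the thresholds. Interlacing mentions only the
  neighbouring ones; monotonicity of \<open>t\<close> supplies the comparison with the
  others.\<close>

lemma window_level_sets:
  fixes t :: "nat \<Rightarrow> nat"
  assumes m: "m \<le> length u" and mono: "\<And>i. Suc i < m \<Longrightarrow> t i < t (Suc i)"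
  shows "window m (level_sets (row_sizes m t) u) \<longleftrightarrow> interlaced m t u"
proof -
  note lt = strict_mono_below[of m t, OF mono]
  have nth: "level_sets (row_sizes m t) u ! p = {k. k < length u \<and> u ! k \<le> t (m - 1 - p)}"
    if "p < m" for p using that by (simp add: level_sets_def)
  have "window m (level_sets (row_sizes m t) u) \<longleftrightarrow>
      (\<forall>p<m. \<forall>k<m. u ! k \<le> t (m - 1 - p) \<longleftrightarrow> p < k)"
  proof -
    have "{k. k < length u \<and> u ! k \<le> t (m - 1 - p)} \<inter> {..<m} = {p + 1..<m} \<longleftrightarrow>
        (\<forall>k<m. u ! k \<le> t (m - 1 - p) \<longleftrightarrow> p < k)" for p
      unfolding Int_lessThan_eq_iff by (intro iff_allI imp_cong refl) (use m in simp)
    moreover have "window m (level_sets (row_sizes m t) u) \<longleftrightarrow>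
        (\<forall>p<m. {k. k < length u \<and> u ! k \<le> t (m - 1 - p)} \<inter> {..<m} = {p + 1..<m})"
    proof -
      have "length (level_sets (row_sizes m t) u) = m" by (simp add: level_sets_def)
      thus ?thesis by (simp add: window_def nth)
    qed
    ultimately show ?thesis by (simp only:)
  qed
  also have "\<dots> \<longleftrightarrow> interlaced m t u"
  proof
    assume W: "\<forall>p<m. \<forall>k<m. u ! k \<le> t (m - 1 - p) \<longleftrightarrow> p < k"
    show "interlaced m t u" unfolding interlaced_def
    proof (intro allI impI conjI)
      fix i assume i: "i < m"
      have p: "m - 1 - i < m" "m - 1 - (m - 1 - i) = i" using i by auto
      show "t i < u ! (m - 1 - i)" using W[rule_format, OF p(1) p(1)] p(2) by simp
      assume "0 < i"
      hence k: "m - 1 - (i - 1) < m" "m - 1 - i < m - 1 - (i - 1)" using i by auto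
      show "u ! (m - 1 - (i - 1)) \<le> t i" using W[rule_format, OF p(1) k(1)] k(2) p(2) by simp
    qed
  next
    assume I: "interlaced m t u"
    show "\<forall>p<m. \<forall>k<m. u ! k \<le> t (m - 1 - p) \<longleftrightarrow> p < k"
    proof (intro allI impI)
      fix p k assume p: "p < m" and k: "k < m"
      show "u ! k \<le> t (m - 1 - p) \<longleftrightarrow> p < k"
      proof (cases "p < k")
        case True
        define i where "i = m - k"
        have i: "i < m" "0 < i" "m - 1 - (i - 1) = k" "i \<le> m - 1 - p" using True k by (auto simp: i_def)
        have "u ! k \<le> t i" using I i unfolding interlaced_def by metis
        also have "t i \<le> t (m - 1 - p)"
          using lt[of i "m - 1 - p"] i(4) p by (cases "i = m - 1 - p") auto
        finally show ?thesis using True by simp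
      next
        case False
        define i where "i = m - 1 - k"
        have i: "i < m" "m - 1 - i = k" "m - 1 - p \<le> i" using False k p by (auto simp: i_def)
        have "t (m - 1 - p) \<le> t i"
          using lt[of "m - 1 - p" i] i p by (cases "i = m - 1 - p") auto
        also have "t i < u ! k" using I i unfolding interlaced_def by metis
        finally show ?thesis using False by simp
      qed
    qed
  qed
  finally show ?thesis .
qed

text \<open>Equal neighbouring thresholds must be allowed, as x_i may coincide with x_(i+1) - 1.
  Then no letter fits between them and the determinant has two equal rows, so both sides
  vanish.\<close>

lemma prob_interlaced:
  fixes t :: "nat \<Rightarrow> nat"
  assumes st: "tasep_stationary N \<pi>" and N: "N > 0" and m: "m \<le> N"
    and mono: "\<And>i. Suc i < m \<Longrightarrow> t i \<le> t (Suc i)" and tN: "\<And>i. i < m \<Longrightarrow> t i \<le> N"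
  shows "measure_pmf.prob \<pi> {u. interlaced m t u} =
    Determinant.det (Matrix.mat m m (\<lambda>(i, j). (real N - real (t i)) * real (t i choose j))) /
    (fact m * (\<Prod>i=1..m. real (N choose i)))"
proof (cases "\<forall>i. Suc i < m \<longrightarrow> t i < t (Suc i)")
  case True
  hence strict: "\<And>i. Suc i < m \<Longrightarrow> t i < t (Suc i)" by blast
  have len: "length u = N" if "u \<in> set_pmf \<pi>" for u
    using st that
    by (auto simp: tasep_stationary_def tasep_states_def permutations_of_set_def dest!: distinct_card)
  have "measure_pmf.prob \<pi> {u. interlaced m t u} =
      measure_pmf.prob \<pi> {u. window m (level_sets (row_sizes m t) u)}"
    using window_level_sets[of m _ t, OF _ strict] len m
    by (intro measure_pmf.finite_measure_eq_AE) (auto simp: AE_measure_pmf_iff)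
  also have "\<dots> = measure_pmf.prob (map_pmf (level_sets (row_sizes m t)) \<pi>) {As. window m As}"
    by (simp add: measure_map_pmf vimage_def)
  also have "map_pmf (level_sets (row_sizes m t)) \<pi> = tandem_law N (row_sizes m t)"
    by (rule level_sets_law[OF st N])
      (use sorted_row_sizes[of m t, OF strict] tN in \<open>auto simp: row_sizes_def\<close>)
  also have "measure_pmf.prob \<dots> {As. window m As} =
    Determinant.det (Matrix.mat m m (\<lambda>(i, j). (real N - real (t i)) * real (t i choose j))) /
    (fact m * (\<Prod>i=1..m. real (N choose i)))"
    by (rule prob_window[of m N t, OF m strict tN])
  finally show ?thesis .
next
  case False
  then obtain i where i: "Suc i < m" "t i = t (Suc i)" using mono by (metis le_neq_implies_less)
  have "\<not> interlaced m t u" for u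
  proof
    assume I: "interlaced m t u"
    have "t i < u ! (m - 1 - i)" using I i(1) unfolding interlaced_def by (metis Suc_lessD)
    moreover have "u ! (m - 1 - (Suc i - 1)) \<le> t (Suc i)"
      using I i(1) unfolding interlaced_def by (metis zero_less_Suc)
    ultimately show False using i(2) by simp
  qed
  moreover have "Determinant.det (Matrix.mat m m
      (\<lambda>(i, j). (real N - real (t i)) * real (t i choose j))) = 0"
    by (rule det_rows_equal[of i m "Suc i"]) (use i in auto)
  ultimately show ?thesis by simp
qed

text \<open>Inclusion-exclusion over the thresholds \<open>x i - 1\<close> and \<open>x i\<close>: reading the product from
  \<open>i = 0\<close> upwards, each factor is the indicator that the next letter is exactly \<open>x i\<close>.\<close>

lemma exact_letters_interlaced:
  fixes x :: "nat \<Rightarrow> nat"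
  assumes x1: "\<And>i. i < m \<Longrightarrow> x i \<ge> 1" and mono: "\<And>i. Suc i < m \<Longrightarrow> x i < x (Suc i)"
  shows "(of_bool (\<forall>i<m. u ! (m - 1 - i) = x i) :: real) =
    (\<Sum>X\<in>Pow {..<m}. (- 1) ^ card X * of_bool (interlaced m (\<lambda>i. x i - of_bool (i \<notin> X)) u))"
proof -
  define y where "y = (\<lambda>i. u ! (m - 1 - i))"
  define \<phi> :: "nat \<Rightarrow> nat \<Rightarrow> real"
    where "\<phi> = (\<lambda>i s. of_bool (s < y i \<and> (i > 0 \<longrightarrow> y (i - 1) \<le> s)))"
  have prod_of_bool: "(\<Prod>i<m. of_bool (P i)) = (of_bool (\<forall>i<m. P i) :: real)" for P
    by (cases "\<forall>i<m. P i") auto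
  have "(\<Prod>i<m. \<phi> i (x i - 1) - \<phi> i (x i)) =
      (\<Sum>X\<in>Pow {..<m}. (- 1) ^ card X * (\<Prod>i\<in>X. \<phi> i (x i)) * (\<Prod>i\<in>{..<m} - X. \<phi> i (x i - 1)))"
    by (rule prod_diff_conv_sum) simp
  also have "\<dots> = (\<Sum>X\<in>Pow {..<m}. (- 1) ^ card X *
      of_bool (interlaced m (\<lambda>i. x i - of_bool (i \<notin> X)) u))"
  proof (rule sum.cong[OF refl])
    fix X assume "X \<in> Pow {..<m}"
    hence X: "{..<m} \<inter> X = X" "{..<m} \<inter> - X = {..<m} - X" by auto
    have "(\<Prod>i\<in>X. \<phi> i (x i)) * (\<Prod>i\<in>{..<m} - X. \<phi> i (x i - 1)) =
        (\<Prod>i<m. if i \<in> X then \<phi> i (x i) else \<phi> i (x i - 1))"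
      by (simp add: prod.If_cases X)
    also have "\<dots> = (\<Prod>i<m. \<phi> i (x i - of_bool (i \<notin> X)))"
      by (rule prod.cong) auto
    also have "\<dots> = of_bool (interlaced m (\<lambda>i. x i - of_bool (i \<notin> X)) u)"
      unfolding \<phi>_def prod_of_bool by (simp add: interlaced_def y_def)
    finally show "(- 1) ^ card X * (\<Prod>i\<in>X. \<phi> i (x i)) * (\<Prod>i\<in>{..<m} - X. \<phi> i (x i - 1)) =
        (- 1) ^ card X * of_bool (interlaced m (\<lambda>i. x i - of_bool (i \<notin> X)) u)"
      by (simp add: mult.assoc)
  qed
  also have "(\<Prod>i<m. \<phi> i (x i - 1) - \<phi> i (x i)) = of_bool (\<forall>i<m. y i = x i)"
  proof -
    have factor: "\<phi> i (x i - 1) - \<phi> i (x i) = of_bool (y i = x i)"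
      if i: "i < m" and below: "\<And>k. k < i \<Longrightarrow> y k = x k" for i
    proof -
      \<comment> \<open>A correct preceding letter is at most \<open>x i - 1\<close>, so the upper
        bound holds at both thresholds and the two indicators differ exactly at
        \<open>y i = x i\<close>.\<close>
      have "y (i - 1) \<le> x i - 1" if "i > 0"
        using below[of "i - 1"] mono[of "i - 1"] that i by simp
      hence "i > 0 \<longrightarrow> y (i - 1) \<le> x i - 1 \<and> y (i - 1) \<le> x i" by fastforce
      hence "\<phi> i (x i - 1) = of_bool (x i - 1 < y i)" "\<phi> i (x i) = of_bool (x i < y i)"
        by (auto simp: \<phi>_def)
      thus ?thesis using x1[OF i] by (auto simp: of_bool_def)
    qed
    show ?thesis
    proof (cases "\<forall>i<m. y i = x i")
      case True
      have "(\<Prod>i<m. \<phi> i (x i - 1) - \<phi> i (x i)) = (\<Prod>i<m. 1)"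
        by (rule prod.cong) (use True factor in auto)
      thus ?thesis using True by simp
    next
      case False
      hence "\<exists>i. i < m \<and> y i \<noteq> x i" by blast
      \<comment> \<open>The first wrong letter is taken because a factor is known to be an indicator
        only when all letters before it are correct; its factor 0 kills the product.\<close>
      then obtain i where i: "i < m" "y i \<noteq> x i" "\<And>k. k < i \<Longrightarrow> \<not> (k < m \<and> y k \<noteq> x k)"
        using exists_least_iff[of "\<lambda>i. i < m \<and> y i \<noteq> x i"] by blast
      hence "\<phi> i (x i - 1) - \<phi> i (x i) = 0" by (subst factor) auto
      hence "(\<Prod>i<m. \<phi> i (x i - 1) - \<phi> i (x i)) = 0" using i(1) by (intro prod_zero) auto
      moreover have "of_bool (\<forall>i<m. y i = x i) = (0 :: real)" using False by simp
      ultimately show ?thesis by (simp only:)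
    qed
  qed
  finally show ?thesis by (simp add: y_def)
qed

lemma prob_eq_sum:
  assumes "finite X" "set_pmf p \<subseteq> X"
  shows "measure_pmf.prob p {u. P u} = (\<Sum>u\<in>X. pmf p u * of_bool (P u))"
proof -
  have "measure_pmf.prob p {u. P u} = measure_pmf.prob p {u \<in> X. P u}"
    using assms(2) by (intro measure_pmf.finite_measure_eq_AE) (auto simp: AE_measure_pmf_iff)
  also have "\<dots> = (\<Sum>u\<in>{u \<in> X. P u}. pmf p u)"
    using assms(1) by (intro measure_measure_pmf_finite) simp
  also have "\<dots> = (\<Sum>u\<in>X. pmf p u * of_bool (P u))"
    using assms(1) by (simp add: of_bool_def sum.inter_filter if_distrib cong: if_cong)
  finally show ?thesis .
qed

theorem theoremT:
  fixes N n :: nat and x :: "nat \<Rightarrow> nat" and \<pi> :: "nat list pmf"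
  assumes "N \<ge> 1" and "n \<ge> 2"
    and "x n \<le> N" and "\<forall>i\<in>{2..<n}. x i < x (i + 1)" and "1 \<le> x 2"
    and "tasep_stationary N \<pi>"
  shows "measure_pmf.prob \<pi> {u. take (n - 1) u = rev (map x [2..<n + 1])} =
    1 / (\<Prod>i = 1..n - 1. real (N choose i)) *
    Determinant.det (Matrix.mat (n - 1) (n - 1) (\<lambda>(i, j). real (x (i + 2) choose j)))"
proof -
  define m where "m = n - 1"
  define z where "z = (\<lambda>i. x (i + 2))"
  define c where "c = fact m * (\<Prod>i=1..m. real (N choose i))"
  have mn: "n = Suc m" "m > 0" using assms(2) by (auto simp: m_def)
  have mono: "z i < z (Suc i)" if "Suc i < m" for i
    using assms(4)[rule_format, of "i + 2"] that by (simp add: z_def mn)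
  \<comment> \<open>At \<open>i = m - 1\<close> this bound yields \<open>m \<le> N\<close>.\<close>
  have lower: "Suc i \<le> z i" if "i < m" for i
    using that
  proof (induction i)
    case (Suc i)
    thus ?case using mono[of i] by simp
  qed (use assms(5) in \<open>simp add: z_def numeral_2_eq_2\<close>)
  have zN: "z i \<le> N" if "i < m" for i
  proof -
    have "z i \<le> z (m - 1)"
      using strict_mono_below[of m z, OF mono, of i "m - 1"] that by (cases "i = m - 1") fastforce+
    also have "z (m - 1) = x n" using mn by (simp add: z_def)
    finally show ?thesis using assms(3) by simp
  qed
  have mN: "m \<le> N" using lower[of "m - 1"] zN[of "m - 1"] mn by simp
  have z1: "z i \<ge> 1" if "i < m" for i using lower[OF that] by simp
  let ?S = "tasep_states N"
  have S: "finite ?S" "set_pmf \<pi> \<subseteq> ?S"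
    using assms(6) by (auto simp: tasep_states_def tasep_stationary_def)
  have exact: "take m u = rev (map x [2..<n + 1]) \<longleftrightarrow> (\<forall>i<m. u ! (m - 1 - i) = z i)"
    if "u \<in> ?S" for u
  proof -
    have "length u = N"
      using that by (auto simp: tasep_states_def permutations_of_set_def dest!: distinct_card)
    moreover have "rev (map x [2..<n + 1]) ! k = z (m - 1 - k)" if "k < m" for k
      using that by (simp add: rev_nth mn z_def del: upt_Suc)
    ultimately have "take m u = rev (map x [2..<n + 1]) \<longleftrightarrow> (\<forall>k<m. u ! k = z (m - 1 - k))"
      using mN by (auto simp: list_eq_iff_nth_eq mn simp del: upt_Suc rev_map)
    also have "\<dots> \<longleftrightarrow> (\<forall>i<m. u ! (m - 1 - i) = z i)"
    proof safe
      fix i assume *: "\<forall>k<m. u ! k = z (m - 1 - k)" "i < m"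
      show "u ! (m - 1 - i) = z i" using *(1)[rule_format, of "m - 1 - i"] *(2) by simp
    next
      fix k assume *: "\<forall>i<m. u ! (m - 1 - i) = z i" "k < m"
      show "u ! k = z (m - 1 - k)" using *(1)[rule_format, of "m - 1 - k"] *(2) by simp
    qed
    finally show ?thesis .
  qed
  have "measure_pmf.prob \<pi> {u. take m u = rev (map x [2..<n + 1])} =
      (\<Sum>u\<in>?S. pmf \<pi> u * of_bool (\<forall>i<m. u ! (m - 1 - i) = z i))"
    unfolding prob_eq_sum[OF S] using exact by (intro sum.cong refl) simp
  also have "\<dots> = (\<Sum>u\<in>?S. \<Sum>X\<in>Pow {..<m}. (- 1) ^ card X *
      (pmf \<pi> u * of_bool (interlaced m (\<lambda>i. z i - of_bool (i \<notin> X)) u)))"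
  proof (rule sum.cong[OF refl])
    fix u
    have "(of_bool (\<forall>i<m. u ! (m - 1 - i) = z i) :: real) =
        (\<Sum>X\<in>Pow {..<m}. (- 1) ^ card X * of_bool (interlaced m (\<lambda>i. z i - of_bool (i \<notin> X)) u))"
      by (rule exact_letters_interlaced[of m z u, OF z1 mono])
    thus "pmf \<pi> u * of_bool (\<forall>i<m. u ! (m - 1 - i) = z i) = (\<Sum>X\<in>Pow {..<m}. (- 1) ^ card X *
        (pmf \<pi> u * of_bool (interlaced m (\<lambda>i. z i - of_bool (i \<notin> X)) u)))"
      by (simp only: sum_distrib_left mult.left_commute)
  qed
  also have "\<dots> = (\<Sum>X\<in>Pow {..<m}. (- 1) ^ card X *
      measure_pmf.prob \<pi> {u. interlaced m (\<lambda>i. z i - of_bool (i \<notin> X)) u})"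
    unfolding prob_eq_sum[OF S] sum_distrib_left by (rule sum.swap)
  also have "\<dots> = (\<Sum>X\<in>Pow {..<m}. (- 1) ^ card X * Determinant.det (Matrix.mat m m (\<lambda>(i, j).
      (real N - real (z i - of_bool (i \<notin> X))) * real ((z i - of_bool (i \<notin> X)) choose j)))) / c"
    unfolding sum_divide_distrib
  proof (rule sum.cong[OF refl])
    fix X :: "nat set"
    \<comment> \<open>Lowering some thresholds by one can turn a strict step into an equality, but
      not into a descent.\<close>
    have "z i - of_bool (i \<notin> X) \<le> z (Suc i) - of_bool (Suc i \<notin> X)" if "Suc i < m" for i
      using mono[OF that] by (cases "i \<in> X"; cases "Suc i \<in> X") auto
    moreover have "z i - of_bool (i \<notin> X) \<le> N" if "i < m" for i using zN[OF that] by simp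
    ultimately show "(- 1) ^ card X * measure_pmf.prob \<pi> {u. interlaced m (\<lambda>i. z i - of_bool (i \<notin> X)) u} =
      (- 1) ^ card X * Determinant.det (Matrix.mat m m (\<lambda>(i, j).
        (real N - real (z i - of_bool (i \<notin> X))) * real ((z i - of_bool (i \<notin> X)) choose j))) / c"
      using assms(1) by (subst prob_interlaced[OF assms(6) _ mN]) (auto simp: c_def)
  qed
  also have "\<dots> = fact m * Determinant.det (Matrix.mat m m (\<lambda>(i, j). real (z i choose j))) / c"
    by (subst det_binomial_difference[OF z1]) simp_all
  also have "\<dots> = 1 / (\<Prod>i = 1..m. real (N choose i)) *
      Determinant.det (Matrix.mat m m (\<lambda>(i, j). real (z i choose j)))"
    by (simp add: c_def)
  finally show ?thesis by (simp only: m_def z_def)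
qed

end
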